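(* Let $\Gamma_{M}$ and $\Gamma_{\rm tot}$ be finite sets such that $\Gamma_M\cup\tau$ generates $M_{2,1}$ and $\Gamma_{\rm tot}\cup\tau$ generates $\mathsf{tot}M_{2,1}$. For each $\gamma\in\Gamma_M$ let $\overline{\gamma}\in(\Gamma_{\rm tot}\cup\tau)^*$ be a chosen word with $E_{\overline\gamma}\in\varrho^{-1}(\gamma)\subseteq F_0$, and for each $\tau_{i,j}\in\tau$ let $\overline{\tau}_{i,j}$ be the (log-space constructible) chosen word over $\Gamma_{\rm tot}\cup\tau$ that represents the function $0x\mapsto0x$, $1x\mapsto\tau_{i+1,j+1}(1x)$. For any $w=w_n\cdots w_1\in(\Gamma_M\cup\tau)^*$ with $w_i\in\Gamma_M\cup\tau$, let $E_w=w_n\circ\cdots\circ w_1\in M_{2,1}$ be the function generated, and let $W=\overline{w}_n\cdots\overline{w}_1\in(\Gamma_{\rm tot}\cup\tau)^*$ be obtained by completing each generator and concatenating; $W$ generates the total function $E_W=E_{\overline{w}_n}\circ\cdots\circ E_{\overline{w}_1}\in F_0\subseteq\mathsf{tot}M_{2,1}$. Then $E_W$ is a completion of $E_w$, i.e. $\varrho(E_W)=E_w$. The word $W$ can be computed from $w$ in log-space.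
   Context: The alphabet is $\{0,1\}$. A prefix code is a set of strings none of which is a proper prefix of another. A right-ideal morphism is a partial function $f:\{0,1\}^*\to\{0,1\}^*$ whose domain is a right ideal (a set $R$ with $R=R\{0,1\}^*$) and such that $f(xu)=f(x)u$ for all $x\in\mathrm{Dom}(f)$, $u\in\{0,1\}^*$; its domain code is the unique prefix code generating $\mathrm{Dom}(f)$. $M_{2,1}$ is the monoid of right-ideal morphisms with finite domain code modulo the congruence: $f\equiv_{\rm fin}g$ iff $\mathrm{Dom}(f)\triangle\mathrm{Dom}(g)$ is finite and $f,g$ agree on $\mathrm{Dom}(f)\cap\mathrm{Dom}(g)$. Elements of $M_{2,1}$ are identified with partial functions on $\{0,1\}^\omega$ via $f(xz)=f(x)z$; $\mathsf{tot}M_{2,1}$ is the submonoid of total functions on $\{0,1\}^\omega$. $\tau=\{\tau_{i,j}:1\le i<j\}$, where $\tau_{i,j}$ exchanges the bits at positions $i$ and $j$. For a word $w=w_n\cdots w_1$ of generators, $E_w=w_n\circ\cdots\circ w_1$. $F_0=\{f\in\mathsf{tot}M_{2,1}: f(0z)=0z\text{ for all }z\in\{0,1\}^\omega\}$, and $\varrho:F_0\to M_{2,1}$ is the surjective monoid homomorphism for which $\varrho(f)$ is the partial function on $\{0,1\}^\omega$ with $\varrho(f)(z)=y$ iff $f(1z)=1y$. A completion of $f\in M_{2,1}$ is any element of $\varrho^{-1}(f)$. For space complexity, a transposition $\tau_{i,j}$ in a word counts with length $j$. *)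

theory Defs
  imports Complex_Main "HOL-Library.Stream" "HOL-Library.Sublist"
begin

section \<open>Right-ideal morphisms and the monoid \<open>M\<^sub>2\<^sub>,\<^sub>1\<close>\<close>

text \<open>The bits 0 and 1 are \<^const>\<open>False\<close> and \<^const>\<open>True\<close>; elements of \<open>{0,1}\<^sup>\<omega>\<close> are streams.\<close>

definition prefix_code :: "bool list set \<Rightarrow> bool" where
  "prefix_code P \<longleftrightarrow> (\<forall>x\<in>P. \<forall>y\<in>P. \<not> strict_prefix x y)"

definition ideal_of :: "bool list set \<Rightarrow> bool list set" where
  "ideal_of P = {p @ u | p u. p \<in> P}"

definition right_ideal :: "bool list set \<Rightarrow> bool" where
  "right_ideal R \<longleftrightarrow> R = ideal_of R"

definition ri_morphism :: "(bool list \<rightharpoonup> bool list) \<Rightarrow> bool" where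
  "ri_morphism f \<longleftrightarrow> right_ideal (dom f) \<and>
     (\<forall>x\<in>dom f. \<forall>u. f (x @ u) = Some (the (f x) @ u))"

definition dom_code :: "(bool list \<rightharpoonup> bool list) \<Rightarrow> bool list set" where
  "dom_code f = (THE P. prefix_code P \<and> ideal_of P = dom f)"

definition RM_fin :: "(bool list \<rightharpoonup> bool list) set" where
  "RM_fin = {f. ri_morphism f \<and> finite (dom_code f)}"

definition fin_cong :: "((bool list \<rightharpoonup> bool list) \<times> (bool list \<rightharpoonup> bool list)) set" where
  "fin_cong = {(f, g). f \<in> RM_fin \<and> g \<in> RM_fin \<and>
     finite ((dom f - dom g) \<union> (dom g - dom f)) \<and>
     (\<forall>x\<in>dom f \<inter> dom g. f x = g x)}"

type_synonym elem = "(bool list \<rightharpoonup> bool list) set"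

definition M21 :: "elem set" where
  "M21 = RM_fin // fin_cong"

definition M_one :: elem where
  "M_one = fin_cong `` {Some}"

definition M_comp :: "elem \<Rightarrow> elem \<Rightarrow> elem" where
  "M_comp F G = (\<Union>f\<in>F. \<Union>g\<in>G. fin_cong `` {f \<circ>\<^sub>m g})"

text \<open>The partial function on \<open>{0,1}\<^sup>\<omega>\<close> with which an element of \<open>M\<^sub>2\<^sub>,\<^sub>1\<close> is identified.\<close>

definition acts_to :: "elem \<Rightarrow> bool stream \<Rightarrow> bool stream \<Rightarrow> bool" where
  "acts_to F z y \<longleftrightarrow> (\<exists>f\<in>F. \<exists>x u v. f x = Some u \<and> z = x @- v \<and> y = u @- v)"

definition act :: "elem \<Rightarrow> bool stream \<rightharpoonup> bool stream" where
  "act F z = (if \<exists>y. acts_to F z y then Some (THE y. acts_to F z y) else None)"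

definition totM21 :: "elem set" where
  "totM21 = {F \<in> M21. \<forall>z. act F z \<noteq> None}"

text \<open>Positions are counted from 1, and \<open>\<tau>\<^sub>i\<^sub>,\<^sub>j\<close> has domain code \<open>{0,1}\<^sup>j\<close>.\<close>

definition tau_map :: "nat \<Rightarrow> nat \<Rightarrow> bool list \<rightharpoonup> bool list" where
  "tau_map i j x = (if j \<le> length x
     then Some (x[i - 1 := x ! (j - 1), j - 1 := x ! (i - 1)]) else None)"

definition tau :: "nat \<Rightarrow> nat \<Rightarrow> elem" where
  "tau i j = fin_cong `` {tau_map i j}"

section \<open>Completions\<close>

definition F0 :: "elem set" where
  "F0 = {F \<in> totM21. \<forall>z. act F (False ## z) = Some (False ## z)}"

definition rho :: "elem \<Rightarrow> elem" where
  "rho F = (THE G. G \<in> M21 \<and>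
     (\<forall>z y. act G z = Some y \<longleftrightarrow> act F (True ## z) = Some (True ## y)))"

definition completions :: "elem \<Rightarrow> elem set" where
  "completions G = {F \<in> F0. rho F = G}"

section \<open>Words over \<open>\<Gamma> \<union> \<tau>\<close>\<close>

text \<open>Letters are formal symbols, so \<open>\<Gamma>\<close> may contain some of the \<open>\<tau>\<^sub>i\<^sub>,\<^sub>j\<close>.
  A word \<open>w\<^sub>n\<cdots>w\<^sub>1\<close> is the list with head \<open>w\<^sub>n\<close>.\<close>

datatype letter = Gen elem | Tau nat nat

definition letters :: "elem set \<Rightarrow> letter set" where
  "letters \<Gamma> = Gen ` \<Gamma> \<union> {Tau i j | i j. 1 \<le> i \<and> i < j}"

fun letter_elem :: "letter \<Rightarrow> elem" where
  "letter_elem (Gen \<gamma>) = \<gamma>"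
| "letter_elem (Tau i j) = tau i j"

definition M_prod :: "elem list \<Rightarrow> elem" where
  "M_prod Fs = foldr M_comp Fs M_one"

definition E :: "letter list \<Rightarrow> elem" where
  "E w = M_prod (map letter_elem w)"

definition generates_with_tau :: "elem set \<Rightarrow> elem set \<Rightarrow> bool" where
  "generates_with_tau \<Gamma> M \<longleftrightarrow> E ` lists (letters \<Gamma>) = M"

fun complete_letter ::
    "(elem \<Rightarrow> letter list) \<Rightarrow> (nat \<Rightarrow> nat \<Rightarrow> letter list) \<Rightarrow> letter \<Rightarrow> letter list" where
  "complete_letter bar_gen bar_tau (Gen \<gamma>) = bar_gen \<gamma>"
| "complete_letter bar_gen bar_tau (Tau i j) = bar_tau i j"

definition complete_word ::
    "(elem \<Rightarrow> letter list) \<Rightarrow> (nat \<Rightarrow> nat \<Rightarrow> letter list) \<Rightarrow> letter list \<Rightarrow> letter list" where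
  "complete_word bar_gen bar_tau w = concat (map (complete_letter bar_gen bar_tau) w)"

text \<open>Words are written on tapes over the finite alphabet \<open>\<Gamma> \<union> {a,b}\<close>: a generator in \<open>\<Gamma>\<close> is one
  symbol, and \<open>\<tau>\<^sub>i\<^sub>,\<^sub>j\<close> is the string \<open>a\<^sup>i b\<^sup>j\<^sup>-\<^sup>i\<close> of length \<open>j\<close>. Since
  \<open>1 \<le> i < j\<close>, both blocks are nonempty and the encoding is injective on words.\<close>

datatype symb = Sgen elem | Sa | Sb

definition symbs :: "elem set \<Rightarrow> symb set" where
  "symbs \<Gamma> = Sgen ` \<Gamma> \<union> {Sa, Sb}"

fun enc_letter :: "letter \<Rightarrow> symb list" where
  "enc_letter (Gen \<gamma>) = [Sgen \<gamma>]"
| "enc_letter (Tau i j) = replicate i Sa @ replicate (j - i) Sb"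

definition enc :: "letter list \<Rightarrow> symb list" where
  "enc w = concat (map enc_letter w)"

section \<open>Log-space transducers\<close>

text \<open>Deterministic Turing machines with a two-way read-only input tape delimited by end markers,
  one read-write work tape with cells \<open>0,1,2,\<dots>\<close>, and a write-only output tape. A transition may
  emit a string of output symbols; the value \<^const>\<open>None\<close> means that the machine halts.\<close>

datatype dir = Go_left | Stay | Go_right

datatype 'a scanned = Left_end | Inp 'a | Right_end

record ('a, 'b) transducer =
  states :: "nat set"
  start :: nat
  work_symbs :: "nat set"
  blank :: nat
  trans :: "nat \<Rightarrow> 'a scanned \<Rightarrow> nat \<Rightarrow> (nat \<times> nat \<times> dir \<times> dir \<times> 'b list) option"

text \<open>Only the values of \<^const>\<open>trans\<close> on the finite sets below matter for runs on inputs over \<open>\<Sigma>\<close>.\<close>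

definition transducer_over :: "'a set \<Rightarrow> 'b set \<Rightarrow> ('a, 'b) transducer \<Rightarrow> bool" where
  "transducer_over \<Sigma> \<Delta> T \<longleftrightarrow>
     finite \<Sigma> \<and> finite \<Delta> \<and> finite (states T) \<and> finite (work_symbs T) \<and>
     start T \<in> states T \<and> blank T \<in> work_symbs T \<and>
     (\<forall>q \<in> states T. \<forall>s \<in> insert Left_end (insert Right_end (Inp ` \<Sigma>)). \<forall>c \<in> work_symbs T.
        \<forall>q' c' d e out. trans T q s c = Some (q', c', d, e, out) \<longrightarrow>
          q' \<in> states T \<and> c' \<in> work_symbs T \<and> set out \<subseteq> \<Delta>)"

record 'b config =
  cstate :: nat
  in_pos :: nat
  work :: "nat \<Rightarrow> nat"
  work_pos :: nat
  written :: "'b list"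

definition init_config :: "('a, 'b) transducer \<Rightarrow> 'b config" where
  "init_config T = \<lparr>cstate = start T, in_pos = 0, work = (\<lambda>_. blank T), work_pos = 0, written = []\<rparr>"

definition scan :: "'a list \<Rightarrow> nat \<Rightarrow> 'a scanned" where
  "scan x p = (if p = 0 then Left_end else if p \<le> length x then Inp (x ! (p - 1)) else Right_end)"

fun move :: "dir \<Rightarrow> nat \<Rightarrow> nat" where
  "move Go_left p = p - 1"
| "move Stay p = p"
| "move Go_right p = p + 1"

text \<open>A head that would leave its tape stays where it is.\<close>

definition step :: "('a, 'b) transducer \<Rightarrow> 'a list \<Rightarrow> 'b config \<Rightarrow> 'b config option" where
  "step T x C =
     (case trans T (cstate C) (scan x (in_pos C)) (work C (work_pos C)) of
        None \<Rightarrow> None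
      | Some (q, c, d, e, out) \<Rightarrow>
          Some \<lparr>cstate = q,
                in_pos = min (move d (in_pos C)) (length x + 1),
                work = (work C)(work_pos C := c),
                work_pos = move e (work_pos C),
                written = written C @ out\<rparr>)"

definition reaches :: "('a, 'b) transducer \<Rightarrow> 'a list \<Rightarrow> 'b config \<Rightarrow> bool" where
  "reaches T x C \<longleftrightarrow> (\<lambda>C1 C2. step T x C1 = Some C2)\<^sup>*\<^sup>* (init_config T) C"

text \<open>The function taking \<open>d\<close> to \<open>val d\<close> for \<open>d \<in> D\<close>, with inputs presented as the strings \<open>inp d\<close>
  over \<open>\<Sigma>\<close> and values written as the strings \<open>val d\<close> over \<open>\<Delta>\<close>, is computable in space
  \<open>O(log n)\<close>, where \<open>n\<close> is the input length; the summand 2 only makes the bound meaningful for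
  \<open>n \<le> 1\<close>.\<close>

definition logspace_computable ::
    "'a set \<Rightarrow> 'b set \<Rightarrow> 'd set \<Rightarrow> ('d \<Rightarrow> 'a list) \<Rightarrow> ('d \<Rightarrow> 'b list) \<Rightarrow> bool" where
  "logspace_computable \<Sigma> \<Delta> D inp val \<longleftrightarrow>
     (\<forall>d\<in>D. set (inp d) \<subseteq> \<Sigma>) \<and>
     (\<exists>T :: ('a, 'b) transducer. transducer_over \<Sigma> \<Delta> T \<and>
        (\<forall>d\<in>D. \<exists>C. reaches T (inp d) C \<and> step T (inp d) C = None \<and> written C = val d) \<and>
        (\<exists>k::nat. \<forall>d\<in>D. \<forall>C. reaches T (inp d) C \<longrightarrow>
           real (work_pos C + 1) \<le> real k * log 2 (real (length (inp d) + 2))))"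

end

theory Submission
  imports Defs "HOL-Library.Countable"
begin

text \<open>
  An element of \<open>M\<^sub>2\<^sub>,\<^sub>1\<close> is determined by its partial action on infinite words: the congruence holds
  between two morphisms iff they act alike (\<open>fin_cong_iff\<close>, \<open>M21_eqI\<close>), and the product of classes acts by
  composition (\<open>act_M_comp\<close>). Hence all identities in the monoid can be checked pointwise. In particular
  \<open>\<rho>\<close> is defined on all of \<open>M\<^sub>2\<^sub>,\<^sub>1\<close> as conjugation by \<open>z \<mapsto> 1z\<close> (\<open>rho_in_M21_and_act\<close>), and it is multiplicative
  on \<open>F\<^sub>0\<close> because an element of \<open>F\<^sub>0\<close> never leads from \<open>0{0,1}\<^sup>\<omega>\<close> back to \<open>1{0,1}\<^sup>\<omega>\<close> (\<open>rho_M_comp\<close>). So a product of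
  completions is a completion of the product, and an induction on the word gives the algebraic
  claims (\<open>complete_word_correct\<close>).

  For the space bound, a machine reads \<open>w\<close> from left to right, writes the stored word for each generator
  from \<open>\<Gamma>\<close>, and on each block that encodes some \<open>\<tau>\<^sub>i\<^sub>,\<^sub>j\<close> simulates the given log-space machine for single
  transpositions, reusing the work space from block to block (\<open>run_block\<close>, \<open>logspace_complete_word\<close>).
  A transposition counts with its length \<open>j\<close>, so the space used on one block is logarithmic in the
  length of \<open>w\<close>. Two points need care, since neither the block nor the work tape has end markers that
  could be used: the simulated machine must not notice the neighbours of the block
  (\<open>view_next_mode\<close>), and the work tape must be cleared after each block (\<open>run_clean\<close>).
\<close>

section \<open>Right ideals and finite domain codes\<close>

lemma append_in_ideal_of: "p \<in> P \<Longrightarrow> p @ u \<in> ideal_of P"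
  unfolding ideal_of_def by blast

lemma subset_ideal_of: "P \<subseteq> ideal_of P"
  using append_in_ideal_of[of _ P "[]"] by auto

lemma right_ideal_iff: "right_ideal R \<longleftrightarrow> (\<forall>x\<in>R. \<forall>u. x @ u \<in> R)"
proof -
  have "ideal_of R \<subseteq> R \<longleftrightarrow> (\<forall>x\<in>R. \<forall>u. x @ u \<in> R)" unfolding ideal_of_def by auto
  then show ?thesis using subset_ideal_of[of R] unfolding right_ideal_def by auto
qed

text \<open>The value at a word of the domain determines the values at all its continuations. In this form
  membership of the continuation in the domain, and hence the ideal property, comes for free.\<close>

lemma ri_morphism_iff:
  "ri_morphism f \<longleftrightarrow> (\<forall>x y u. f x = Some y \<longrightarrow> f (x @ u) = Some (y @ u))"
proof
  assume "\<forall>x y u. f x = Some y \<longrightarrow> f (x @ u) = Some (y @ u)"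
  then show "ri_morphism f" unfolding ri_morphism_def right_ideal_iff by fastforce
next
  assume "ri_morphism f"
  then show "\<forall>x y u. f x = Some y \<longrightarrow> f (x @ u) = Some (y @ u)"
    unfolding ri_morphism_def by (metis domI option.sel)
qed

definition minimal_words :: "bool list set \<Rightarrow> bool list set" where
  "minimal_words R = {x \<in> R. \<forall>y\<in>R. \<not> strict_prefix y x}"

lemma minimal_words_ideal_of_subset: "minimal_words (ideal_of Q) \<subseteq> Q"
proof
  fix x assume "x \<in> minimal_words (ideal_of Q)"
  then obtain q u where q: "q \<in> Q" "x = q @ u" and min: "\<forall>y\<in>ideal_of Q. \<not> strict_prefix y x"
    unfolding minimal_words_def ideal_of_def by auto
  have "q \<in> ideal_of Q" using q(1) subset_ideal_of by blast
  then have "\<not> strict_prefix q x" using min by blast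
  then show "x \<in> Q" using q by (auto simp: strict_prefix_def)
qed

lemma minimal_words_of_prefix_code:
  assumes "prefix_code P" shows "minimal_words (ideal_of P) = P"
proof
  show "P \<subseteq> minimal_words (ideal_of P)"
  proof
    fix x assume x: "x \<in> P"
    have "\<not> strict_prefix (p @ u) x" if "p \<in> P" for p u
      using assms x that unfolding prefix_code_def
      by (meson prefixI prefix_order.le_less_trans)
    moreover have "x \<in> ideal_of P" using x subset_ideal_of by blast
    ultimately show "x \<in> minimal_words (ideal_of P)"
      unfolding minimal_words_def ideal_of_def by auto
  qed
qed (rule minimal_words_ideal_of_subset)

lemma ideal_of_minimal_words:
  assumes "right_ideal R" shows "ideal_of (minimal_words R) = R"
proof
  have "ideal_of (minimal_words R) \<subseteq> ideal_of R"
    unfolding ideal_of_def minimal_words_def by auto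
  then show "ideal_of (minimal_words R) \<subseteq> R" using assms unfolding right_ideal_def by simp
  show "R \<subseteq> ideal_of (minimal_words R)"
  proof
    fix x show "x \<in> R \<Longrightarrow> x \<in> ideal_of (minimal_words R)"
    proof (induction x rule: length_induct)
      case (1 x)
      show ?case
      proof (cases "x \<in> minimal_words R")
        case True
        then show ?thesis using subset_ideal_of by blast
      next
        case False
        then obtain y where y: "y \<in> R" "strict_prefix y x" using 1 unfolding minimal_words_def by auto
        then have "y \<in> ideal_of (minimal_words R)" using 1 prefix_length_less by blast
        then show ?thesis using y(2)
          unfolding ideal_of_def strict_prefix_def prefix_def by force
      qed
    qed
  qed
qed

lemma dom_code_eq_minimal_words:
  assumes "right_ideal (dom f)" shows "dom_code f = minimal_words (dom f)"
  unfolding dom_code_def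
proof (rule the_equality)
  show "prefix_code (minimal_words (dom f)) \<and> ideal_of (minimal_words (dom f)) = dom f"
    using ideal_of_minimal_words[OF assms] by (auto simp: prefix_code_def minimal_words_def)
qed (use minimal_words_of_prefix_code in metis)

text \<open>Finiteness of the domain code can be tested on any generating set of the domain, because the
  minimal words of an ideal belong to every set that generates it.\<close>

lemma RM_fin_iff:
  "f \<in> RM_fin \<longleftrightarrow> ri_morphism f \<and> (\<exists>Q. finite Q \<and> dom f = ideal_of Q)"
proof -
  have "finite (dom_code f) \<longleftrightarrow> (\<exists>Q. finite Q \<and> dom f = ideal_of Q)" if "ri_morphism f"
  proof -
    have ri: "right_ideal (dom f)" using that by (simp add: ri_morphism_def)
    show ?thesis
      unfolding dom_code_eq_minimal_words[OF ri]
      by (metis ideal_of_minimal_words[OF ri] finite_subset minimal_words_ideal_of_subset)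
  qed
  then show ?thesis unfolding RM_fin_def by blast
qed

lemma RM_fin_append: "f \<in> RM_fin \<Longrightarrow> f x = Some y \<Longrightarrow> f (x @ u) = Some (y @ u)"
  by (simp add: RM_fin_def ri_morphism_iff)

text \<open>Let \<open>P\<close> and \<open>Q\<close> generate the domains of \<open>f\<close> and \<open>g\<close>. A word \<open>q u\<close> with \<open>q \<in> Q\<close> enters the domain
  of the composite either at once or when \<open>g(q) u\<close> first reaches some \<open>p \<in> P\<close>; in the second case \<open>u\<close>
  is the rest of \<open>p\<close> after \<open>g(q)\<close>. This leaves only finitely many generators.\<close>

lemma RM_fin_comp:
  assumes f: "f \<in> RM_fin" and g: "g \<in> RM_fin" shows "f \<circ>\<^sub>m g \<in> RM_fin"
proof -
  obtain P where P: "finite P" "dom f = ideal_of P" using f unfolding RM_fin_iff by blast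
  obtain Q where Q: "finite Q" "dom g = ideal_of Q" using g unfolding RM_fin_iff by blast
  define S where "S = {q @ u | q u. q \<in> Q \<and> (\<exists>y. g q = Some y \<and> y @ u \<in> P)}
      \<union> {q \<in> Q. \<exists>y. g q = Some y \<and> y \<in> dom f}"
  have "S \<subseteq> (\<Union>q\<in>Q. \<Union>p\<in>P. {q @ drop (length (the (g q))) p}) \<union> Q"
  proof
    fix x assume "x \<in> S"
    then consider q u y where "x = q @ u" "q \<in> Q" "g q = Some y" "y @ u \<in> P" | "x \<in> Q"
      unfolding S_def by blast
    then show "x \<in> (\<Union>q\<in>Q. \<Union>p\<in>P. {q @ drop (length (the (g q))) p}) \<union> Q"
    proof cases
      case 1
      then have "x = q @ drop (length (the (g q))) (y @ u)" by simp
      then show ?thesis using 1 by blast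
    qed simp
  qed
  then have finS: "finite S" by (rule finite_subset) (use P Q in auto)
  have ri: "ri_morphism (f \<circ>\<^sub>m g)"
    unfolding ri_morphism_iff map_comp_Some_iff using RM_fin_append[OF f] RM_fin_append[OF g] by blast
  have "dom (f \<circ>\<^sub>m g) = ideal_of S"
  proof
    show "dom (f \<circ>\<^sub>m g) \<subseteq> ideal_of S"
    proof
      fix x assume "x \<in> dom (f \<circ>\<^sub>m g)"
      then obtain z where z: "g x = Some z" "z \<in> dom f"
        unfolding dom_def mem_Collect_eq by (auto simp: map_comp_Some_iff)
      then obtain q u where q: "q \<in> Q" "x = q @ u" using Q unfolding ideal_of_def by blast
      then have "q \<in> dom g" using Q subset_ideal_of by blast
      then obtain y where y: "g q = Some y" by blast
      then have zz: "z = y @ u" using z q RM_fin_append[OF g] by simp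
      obtain p v where p: "p \<in> P" "z = p @ v" using z P unfolding ideal_of_def by blast
      from zz p(2) have "y @ u = p @ v" by simp
      then consider w where "y = p @ w" | w where "p = y @ w" "u = w @ v"
        by (auto simp: append_eq_append_conv2)
      then show "x \<in> ideal_of S"
      proof cases
        case 1
        then have "y \<in> dom f" using P p append_in_ideal_of by simp
        then have "q \<in> S" unfolding S_def using q y by blast
        then show ?thesis using q append_in_ideal_of by simp
      next
        case 2
        then have "q @ w \<in> S" unfolding S_def using q y p by blast
        then show ?thesis using append_in_ideal_of[of "q @ w" S v] q 2 by simp
      qed
    qed
    have "x \<in> dom (f \<circ>\<^sub>m g)" if "x \<in> S" for x
    proof -
      from that consider q u y where "x = q @ u" "g q = Some y" "y @ u \<in> P"
        | y where "g x = Some y" "y \<in> dom f" unfolding S_def by blast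
      then obtain y where "g x = Some y" "y \<in> dom f"
        using RM_fin_append[OF g] subset_ideal_of[of P] P(2) by cases blast+
      then show ?thesis by (auto simp: map_comp_Some_iff)
    qed
    then show "ideal_of S \<subseteq> dom (f \<circ>\<^sub>m g)"
      using ri unfolding ideal_of_def ri_morphism_def right_ideal_iff by auto
  qed
  then show ?thesis unfolding RM_fin_iff using ri finS by blast
qed

section \<open>The action on infinite words\<close>

definition stream_ext :: "(bool list \<rightharpoonup> bool list) \<Rightarrow> bool stream \<Rightarrow> bool stream \<Rightarrow> bool" where
  "stream_ext f z y \<longleftrightarrow> (\<exists>x u v. f x = Some u \<and> z = x @- v \<and> y = u @- v)"

lemma shift_eq_shift_cases:
  assumes "x @- v = x' @- v'"
  obtains w where "x' = x @ w" "v = w @- v'" | w where "x = x' @ w" "v' = w @- v"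
proof -
  have "(\<exists>w. x' = x @ w \<and> v = w @- v') \<or> (\<exists>w. x = x' @ w \<and> v' = w @- v)"
    using assms
  proof (induction x arbitrary: x')
    case (Cons a x)
    then show ?case by (cases x') auto
  qed auto
  then show ?thesis using that by blast
qed

lemma stream_ext_shift: "f x = Some u \<Longrightarrow> stream_ext f (x @- v) (u @- v)"
  unfolding stream_ext_def by blast

text \<open>Two factorisations of one infinite word can be refined to the longer of the two prefixes, since
  right-ideal morphisms carry continuations along.\<close>

lemma stream_ext_common_prefix:
  assumes f: "f \<in> RM_fin" and z: "stream_ext f z y" and g: "g \<in> RM_fin" and z': "stream_ext g z y'"
  obtains x u u' v where "f x = Some u" "g x = Some u'" "z = x @- v" "y = u @- v" "y' = u' @- v"
proof -
  obtain x u v where 1: "f x = Some u" "z = x @- v" "y = u @- v" using z stream_ext_def by auto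
  obtain x' u' v' where 2: "g x' = Some u'" "z = x' @- v'" "y' = u' @- v'"
    using z' stream_ext_def by auto
  have "x @- v = x' @- v'" using 1 2 by simp
  then show ?thesis
  proof (cases rule: shift_eq_shift_cases)
    case (1 w)
    then show ?thesis using that[of x' "u @ w" u' v'] RM_fin_append[OF f] \<open>f x = Some u\<close> 2
      \<open>y = u @- v\<close> by simp
  next
    case (2 w)
    then show ?thesis using that[of x u "u' @ w" v] RM_fin_append[OF g] \<open>g x' = Some u'\<close> 1
      \<open>y' = u' @- v'\<close> by simp
  qed
qed

lemma stream_ext_functional:
  "f \<in> RM_fin \<Longrightarrow> stream_ext f z y \<Longrightarrow> stream_ext f z y' \<Longrightarrow> y = y'"
  by (metis option.inject stream_ext_common_prefix)

lemma stream_ext_comp: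
  assumes f: "f \<in> RM_fin" and g: "g \<in> RM_fin"
  shows "stream_ext (f \<circ>\<^sub>m g) z y \<longleftrightarrow> (\<exists>z'. stream_ext g z z' \<and> stream_ext f z' y)"
proof
  assume "stream_ext (f \<circ>\<^sub>m g) z y"
  then show "\<exists>z'. stream_ext g z z' \<and> stream_ext f z' y"
    unfolding stream_ext_def map_comp_Some_iff by blast
next
  assume "\<exists>z'. stream_ext g z z' \<and> stream_ext f z' y"
  then obtain x u v x' u' v' where
    1: "g x = Some u" "z = x @- v" and 2: "f x' = Some u'" "u @- v = x' @- v'" "y = u' @- v'"
    unfolding stream_ext_def by blast
  from 2(2) show "stream_ext (f \<circ>\<^sub>m g) z y"
  proof (cases rule: shift_eq_shift_cases)
    case (1 w)
    then have "(f \<circ>\<^sub>m g) (x @ w) = Some u'"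
      using RM_fin_append[OF g \<open>g x = Some u\<close>] 2 by (simp add: map_comp_def)
    then show ?thesis using stream_ext_shift[of _ "x @ w" u' v'] 1 \<open>z = x @- v\<close> 2(3) by simp
  next
    case (2 w)
    then have "(f \<circ>\<^sub>m g) x = Some (u' @ w)"
      using RM_fin_append[OF f \<open>f x' = Some u'\<close>] 1 by (simp add: map_comp_def)
    then show ?thesis using stream_ext_shift[of _ x "u' @ w" v] 2 1 \<open>y = u' @- v'\<close> by simp
  qed
qed

text \<open>One infinite word does not suffice: \<open>w\<^sup>\<omega>\<close> absorbs a prefix \<open>w\<close>. If the same nonempty \<open>w\<close> could be
  cancelled in front of every \<open>v\<close>, then every \<open>v\<close> would start with the first letter of \<open>w\<close>.\<close>

lemma shift_cancel_right:
  assumes "\<And>v. x @- v = y @- (v :: bool stream)" shows "x = y"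
proof -
  have *: "w = []" if "\<And>v. v = w @- (v :: bool stream)" for w
  proof (rule ccontr)
    assume "w \<noteq> []"
    then obtain b w' where "w = b # w'" by (cases w) auto
    then show False using that[of "(\<not> b) ## undefined"] by (metis shift.simps(2) stream.sel(1) stream.inject)
  qed
  have len: "x = y" if eq: "\<And>v. x @- v = y @- (v :: bool stream)" and le: "length x \<le> length y" for x y
  proof -
    have "\<exists>w. y = x @ w"
      using eq[of undefined] by (rule shift_eq_shift_cases) (use le in auto)
    then obtain w where w: "y = x @ w" by blast
    then have "v = w @- v" for v using eq[of v] by simp
    then show ?thesis using * w by simp
  qed
  show ?thesis
  proof (cases "length x \<le> length y")
    case True
    then show ?thesis using len assms by blast
  next
    case False
    then show ?thesis using len[of y x] assms by (metis nat_le_linear)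
  qed
qed

text \<open>If all infinite continuations of a word \<open>x\<close> outside \<open>dom g\<close> can be handled by \<open>g\<close>, then \<open>x\<close> is a
  prefix of one of the finitely many generators of \<open>dom g\<close>.\<close>

lemma finite_dom_diff:
  assumes g: "g \<in> RM_fin" and sub: "\<And>z y. stream_ext f z y \<Longrightarrow> \<exists>y'. stream_ext g z y'"
  shows "finite (dom f - dom g)"
proof -
  obtain Q where Q: "finite Q" "dom g = ideal_of Q" using g unfolding RM_fin_iff by blast
  have "dom f - dom g \<subseteq> (\<Union>q\<in>Q. set (prefixes q))"
  proof
    fix x assume x: "x \<in> dom f - dom g"
    then obtain u where "f x = Some u" by blast
    then have "\<exists>y'. stream_ext g (x @- undefined) y'" using sub stream_ext_shift by blast
    then obtain x' v' where x': "x' \<in> dom g" "x @- undefined = x' @- v'" unfolding stream_ext_def by blast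
    then obtain q t where q: "q \<in> Q" "x' = q @ t" using Q unfolding ideal_of_def by blast
    then have "x @- undefined = q @- (t @- v')" using x' by simp
    then show "x \<in> (\<Union>q\<in>Q. set (prefixes q))"
    proof (cases rule: shift_eq_shift_cases)
      case (1 w)
      show ?thesis by (rule UN_I[OF q(1)]) (simp add: 1(1))
    next
      case (2 w)
      then have "x \<in> dom g" using Q q append_in_ideal_of by simp
      then show ?thesis using x by blast
    qed
  qed
  then show ?thesis by (rule finite_subset) (use Q in auto)
qed

text \<open>Only finitely many words of \<open>dom f\<close> are missing from \<open>dom g\<close>, so a long enough prefix of the
  infinite argument lies in both domains.\<close>

lemma stream_ext_mono_fin_cong:
  assumes f: "f \<in> RM_fin" and fin: "finite (dom f - dom g)"
    and agree: "\<forall>x\<in>dom f \<inter> dom g. f x = g x" and z: "stream_ext f z y"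
  shows "stream_ext g z y"
proof -
  obtain x u v where 1: "f x = Some u" "z = x @- v" "y = u @- v" using z stream_ext_def by auto
  have "inj (\<lambda>n. x @ stake n v)"
    by (rule injI) (metis length_stake same_append_eq)
  then have "infinite (range (\<lambda>n. x @ stake n v))" using finite_imageD by blast
  then obtain n where "x @ stake n v \<notin> dom f - dom g" using fin by (meson finite_subset image_subsetI)
  moreover have *: "f (x @ stake n v) = Some (u @ stake n v)" by (rule RM_fin_append[OF f 1(1)])
  ultimately have "g (x @ stake n v) = Some (u @ stake n v)" using agree by (metis Diff_iff Int_iff domI)
  from stream_ext_shift[of g, OF this, of "sdrop n v"] show ?thesis using 1 by (simp add: stake_sdrop)
qed

text \<open>This replaces the symmetric difference of domains by a plain equality of actions, from which
  transitivity of the congruence and its compatibility with composition are immediate.\<close>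

lemma fin_cong_iff:
  "(f, g) \<in> fin_cong \<longleftrightarrow> f \<in> RM_fin \<and> g \<in> RM_fin \<and> stream_ext f = stream_ext g"
proof safe
  assume *: "(f, g) \<in> fin_cong"
  show fg: "f \<in> RM_fin" "g \<in> RM_fin" using * by (auto simp: fin_cong_def)
  have "stream_ext f z y \<longleftrightarrow> stream_ext g z y" for z y
    using * fg stream_ext_mono_fin_cong[of f g z y] stream_ext_mono_fin_cong[of g f z y]
    unfolding fin_cong_def by auto
  then show "stream_ext f = stream_ext g" by blast
next
  assume fg: "f \<in> RM_fin" "g \<in> RM_fin" and eq: "stream_ext f = stream_ext g"
  have "finite (dom f - dom g)" "finite (dom g - dom f)"
    using finite_dom_diff[OF fg(2), of f] finite_dom_diff[OF fg(1), of g] eq by auto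
  moreover have "f x = g x" if "x \<in> dom f \<inter> dom g" for x
  proof -
    obtain u u' where u: "f x = Some u" "g x = Some u'" using \<open>x \<in> dom f \<inter> dom g\<close> by blast
    have "u @- v = u' @- v" for v
      using stream_ext_shift[of f, OF u(1), of v] stream_ext_shift[of g, OF u(2), of v] eq
        stream_ext_functional[OF fg(2)] by metis
    then show ?thesis using shift_cancel_right u by metis
  qed
  ultimately show "(f, g) \<in> fin_cong" using fg unfolding fin_cong_def by blast
qed

lemma fin_cong_class: "f \<in> RM_fin \<Longrightarrow> fin_cong `` {f} = {g \<in> RM_fin. stream_ext g = stream_ext f}"
  by (auto simp: fin_cong_iff)

lemma acts_to_class: "f \<in> RM_fin \<Longrightarrow> acts_to (fin_cong `` {f}) = stream_ext f"
  unfolding acts_to_def fin_cong_class stream_ext_def[symmetric] by fastforce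

lemma act_class:
  assumes f: "f \<in> RM_fin" shows "act (fin_cong `` {f}) z = Some y \<longleftrightarrow> stream_ext f z y"
proof -
  have "(THE y. stream_ext f z y) = y" if "stream_ext f z y" for y
    using that stream_ext_functional[OF f] by blast
  then show ?thesis unfolding act_def acts_to_class[OF f] by auto
qed

lemma M21_cases:
  assumes "F \<in> M21"
  obtains f where "f \<in> RM_fin" "F = fin_cong `` {f}" "\<forall>z y. act F z = Some y \<longleftrightarrow> stream_ext f z y"
proof -
  obtain f where f: "f \<in> RM_fin" "F = fin_cong `` {f}"
    using assms unfolding M21_def by (rule quotientE)
  show ?thesis by (rule that[OF f]) (simp add: f act_class)
qed

lemma class_in_M21: "f \<in> RM_fin \<Longrightarrow> fin_cong `` {f} \<in> M21"
  unfolding M21_def by (rule quotientI)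

lemma M21_eqI:
  assumes F: "F \<in> M21" and G: "G \<in> M21" and eq: "\<And>z y. act F z = Some y \<longleftrightarrow> act G z = Some y"
  shows "F = G"
proof -
  obtain f where f: "f \<in> RM_fin" "F = fin_cong `` {f}" "\<forall>z y. act F z = Some y \<longleftrightarrow> stream_ext f z y"
    using F by (rule M21_cases)
  obtain g where g: "g \<in> RM_fin" "G = fin_cong `` {g}" "\<forall>z y. act G z = Some y \<longleftrightarrow> stream_ext g z y"
    using G by (rule M21_cases)
  have "stream_ext f = stream_ext g" by (intro ext) (use f(3) g(3) eq in simp)
  then show ?thesis unfolding f(2) g(2) fin_cong_class[OF f(1)] fin_cong_class[OF g(1)] by simp
qed

lemma M_comp_class:
  assumes f: "f \<in> RM_fin" and g: "g \<in> RM_fin"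
  shows "M_comp (fin_cong `` {f}) (fin_cong `` {g}) = fin_cong `` {f \<circ>\<^sub>m g}"
proof -
  have eq: "fin_cong `` {f' \<circ>\<^sub>m g'} = fin_cong `` {f \<circ>\<^sub>m g}"
    if "f' \<in> fin_cong `` {f}" "g' \<in> fin_cong `` {g}" for f' g'
  proof -
    have *: "f' \<in> RM_fin" "g' \<in> RM_fin" "stream_ext f' = stream_ext f" "stream_ext g' = stream_ext g"
      using that by (auto simp: fin_cong_iff)
    then have "stream_ext (f' \<circ>\<^sub>m g') = stream_ext (f \<circ>\<^sub>m g)"
      using stream_ext_comp[OF f g] stream_ext_comp[OF *(1,2)] by (simp add: fun_eq_iff)
    then show ?thesis
      using fin_cong_class[OF RM_fin_comp[OF f g]] fin_cong_class[OF RM_fin_comp[OF *(1,2)]] by simp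
  qed
  have "fin_cong `` {f} \<noteq> {}" "fin_cong `` {g} \<noteq> {}"
    unfolding fin_cong_class[OF f] fin_cong_class[OF g] using f g by auto
  moreover have "M_comp (fin_cong `` {f}) (fin_cong `` {g}) =
      (\<Union>f'\<in>fin_cong `` {f}. \<Union>g'\<in>fin_cong `` {g}. fin_cong `` {f \<circ>\<^sub>m g})"
    unfolding M_comp_def by (intro SUP_cong refl eq)
  ultimately show ?thesis by simp
qed

lemma M_comp_in_M21: "F \<in> M21 \<Longrightarrow> G \<in> M21 \<Longrightarrow> M_comp F G \<in> M21"
  by (elim M21_cases) (simp add: M_comp_class RM_fin_comp class_in_M21)

lemma act_M_comp:
  assumes "F \<in> M21" "G \<in> M21"
  shows "act (M_comp F G) z = Some y \<longleftrightarrow> (\<exists>z'. act G z = Some z' \<and> act F z' = Some y)"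
proof -
  obtain f where f: "f \<in> RM_fin" "F = fin_cong `` {f}" "\<forall>z y. act F z = Some y \<longleftrightarrow> stream_ext f z y"
    using assms(1) by (rule M21_cases)
  obtain g where g: "g \<in> RM_fin" "G = fin_cong `` {g}" "\<forall>z y. act G z = Some y \<longleftrightarrow> stream_ext g z y"
    using assms(2) by (rule M21_cases)
  show ?thesis
    using f(3) g(3) stream_ext_comp[OF f(1) g(1)] act_class[OF RM_fin_comp[OF f(1) g(1)]]
    unfolding f(2) g(2) M_comp_class[OF f(1) g(1)] by simp
qed

lemma Some_in_RM_fin: "Some \<in> RM_fin"
  unfolding RM_fin_iff by (auto simp: ri_morphism_iff ideal_of_def intro!: exI[of _ "{[]}"])

lemma M_one_in_M21: "M_one \<in> M21"
  unfolding M_one_def by (rule class_in_M21[OF Some_in_RM_fin])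

lemma act_M_one: "act M_one z = Some z"
  unfolding M_one_def act_class[OF Some_in_RM_fin] using stream_ext_shift[of Some "[]" "[]" z] by simp

lemma tau_map_append:
  assumes "1 \<le> i" "i < j" "tau_map i j x = Some y" shows "tau_map i j (x @ u) = Some (y @ u)"
  using assms by (auto simp: tau_map_def list_update_append nth_append split: if_splits)

text \<open>The domain code of \<open>\<tau>\<^sub>i\<^sub>,\<^sub>j\<close> consists of the \<open>2\<^sup>j\<close> words of length \<open>j\<close>.\<close>

lemma tau_map_in_RM_fin:
  assumes "1 \<le> i" "i < j" shows "tau_map i j \<in> RM_fin"
proof -
  have "dom (tau_map i j) = ideal_of {x. length x = j}"
  proof
    show "dom (tau_map i j) \<subseteq> ideal_of {x. length x = j}"
    proof
      fix x assume "x \<in> dom (tau_map i j)"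
      then have "j \<le> length x" by (auto simp: tau_map_def split: if_splits)
      then have "x = take j x @ drop j x" "length (take j x) = j" by auto
      then show "x \<in> ideal_of {x. length x = j}" unfolding ideal_of_def by blast
    qed
  qed (auto simp: ideal_of_def tau_map_def)
  moreover have "finite {x :: bool list. length x = j}"
    using finite_lists_length_eq[of "UNIV :: bool set" j] by simp
  ultimately show ?thesis
    unfolding RM_fin_iff ri_morphism_iff using tau_map_append[OF assms] by blast
qed

lemma tau_in_M21: "1 \<le> i \<Longrightarrow> i < j \<Longrightarrow> tau i j \<in> M21"
  unfolding tau_def by (rule class_in_M21[OF tau_map_in_RM_fin])

lemma act_tau_total:
  assumes "1 \<le> i" "i < j" obtains y where "act (tau i j) z = Some y"
proof -
  obtain u where "tau_map i j (stake j z) = Some u" by (simp add: tau_map_def)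
  from stream_ext_shift[of "tau_map i j", OF this, of "sdrop j z"]
  show ?thesis using that unfolding tau_def act_class[OF tau_map_in_RM_fin[OF assms]]
    by (simp add: stake_sdrop)
qed

lemma act_tau_Suc:
  assumes ij: "1 \<le> i" "i < j" and y: "act (tau i j) z = Some y"
  shows "act (tau (i + 1) (j + 1)) (b ## z) = Some (b ## y)"
proof -
  obtain x u v where x: "tau_map i j x = Some u" "z = x @- v" "y = u @- v"
    using y unfolding tau_def act_class[OF tau_map_in_RM_fin[OF ij]] stream_ext_def by blast
  obtain i' j' where "i = Suc i'" "j = Suc j'" using ij by (metis One_nat_def Suc_le_D less_imp_le_nat order_trans)
  then have "tau_map (i + 1) (j + 1) (b # x) = Some (b # u)"
    using x(1) by (auto simp: tau_map_def split: if_splits)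
  from stream_ext_shift[of "tau_map (i + 1) (j + 1)", OF this, of v]
  show ?thesis using x ij unfolding tau_def by (simp add: act_class tau_map_in_RM_fin)
qed

section \<open>Completions\<close>

text \<open>The homomorphism \<open>\<rho>\<close> is conjugation by the injection \<open>z \<mapsto> 1z\<close>: the maps \<open>x \<mapsto> 1x\<close> and \<open>1x \<mapsto> x\<close> are
  themselves right-ideal morphisms with one-word domain codes, so \<open>\<rho>(F)\<close> is a product in
  \<open>M\<^sub>2\<^sub>,\<^sub>1\<close>.\<close>

definition prepend_one :: "bool list \<rightharpoonup> bool list" where
  "prepend_one x = Some (True # x)"

definition strip_one :: "bool list \<rightharpoonup> bool list" where
  "strip_one x = (case x of True # y \<Rightarrow> Some y | _ \<Rightarrow> None)"

lemma strip_one_Some: "strip_one x = Some y \<longleftrightarrow> x = True # y"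
  by (auto simp: strip_one_def split: list.splits bool.splits)

lemma prepend_one_in_RM_fin: "prepend_one \<in> RM_fin"
  unfolding RM_fin_iff
  by (auto simp: ri_morphism_iff ideal_of_def prepend_one_def intro!: exI[of _ "{[]}"])

lemma strip_one_in_RM_fin: "strip_one \<in> RM_fin"
  unfolding RM_fin_iff
proof
  have "dom strip_one = ideal_of {[True]}" by (auto simp: ideal_of_def strip_one_Some dom_def)
  then show "\<exists>Q. finite Q \<and> dom strip_one = ideal_of Q" by blast
qed (simp add: ri_morphism_iff strip_one_Some)

lemma act_prepend_one: "act (fin_cong `` {prepend_one}) z = Some y \<longleftrightarrow> y = True ## z"
proof -
  have "stream_ext prepend_one z (True ## z)"
    using stream_ext_shift[of prepend_one "[]" "[True]" z] by (simp add: prepend_one_def)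
  then show ?thesis unfolding act_class[OF prepend_one_in_RM_fin]
    using stream_ext_functional[OF prepend_one_in_RM_fin] by blast
qed

lemma act_strip_one: "act (fin_cong `` {strip_one}) z = Some y \<longleftrightarrow> z = True ## y"
proof -
  have "stream_ext strip_one (True ## y) y"
    using stream_ext_shift[of strip_one "[True]" "[]" y] by (simp add: strip_one_Some)
  then show ?thesis unfolding act_class[OF strip_one_in_RM_fin]
    by (auto simp: stream_ext_def strip_one_Some)
qed

text \<open>The definite description in \<open>rho\<close> denotes: a witness is the product with the two maps above, and
  it is unique because the action determines the element.\<close>

lemma rho_in_M21_and_act:
  assumes F: "F \<in> M21"
  shows "rho F \<in> M21 \<and>
    (\<forall>z y. act (rho F) z = Some y \<longleftrightarrow> act F (True ## z) = Some (True ## y))"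
  unfolding rho_def
proof (rule theI')
  let ?G = "M_comp (fin_cong `` {strip_one}) (M_comp F (fin_cong `` {prepend_one}))"
  let ?P = "\<lambda>G. G \<in> M21 \<and> (\<forall>z y. act G z = Some y \<longleftrightarrow> act F (True ## z) = Some (True ## y))"
  have G: "?P ?G"
    using F by (auto simp: act_M_comp M_comp_in_M21 class_in_M21 prepend_one_in_RM_fin
        strip_one_in_RM_fin act_prepend_one act_strip_one)
  moreover have "H = ?G" if "?P H" for H
    by (rule M21_eqI) (use that G in auto)
  ultimately show "\<exists>!G. ?P G" by (rule ex1I)
qed

lemma rho_eqI:
  assumes "F \<in> M21" "G \<in> M21"
    and "\<And>z y. act G z = Some y \<longleftrightarrow> act F (True ## z) = Some (True ## y)"
  shows "rho F = G"
  using rho_in_M21_and_act[OF assms(1)] assms(2,3) by (intro M21_eqI) auto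

lemma F0_I:
  assumes "F \<in> M21" "\<And>z. act F (False ## z) = Some (False ## z)"
    "\<And>z. \<exists>y. act F (True ## z) = Some y"
  shows "F \<in> F0"
proof -
  have "act F z \<noteq> None" for z
  proof -
    obtain b t where "z = b ## t" by (cases z)
    then show ?thesis using assms(2)[of t] assms(3)[of t] by (cases b) auto
  qed
  then show ?thesis using assms unfolding F0_def totM21_def by blast
qed

lemma F0_D:
  assumes "F \<in> F0"
  shows "F \<in> M21" "act F (False ## z) = Some (False ## z)" "\<exists>y. act F z = Some y"
  using assms unfolding F0_def totM21_def by auto

lemma M_one_in_F0: "M_one \<in> F0"
  by (rule F0_I) (simp_all add: M_one_in_M21 act_M_one)

lemma rho_M_one: "rho M_one = M_one"
  by (rule rho_eqI) (simp_all add: M_one_in_M21 act_M_one)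

lemma M_comp_in_F0:
  assumes F: "F \<in> F0" and G: "G \<in> F0" shows "M_comp F G \<in> F0"
  using F0_D[OF F] F0_D[OF G] by (intro F0_I) (auto simp: act_M_comp M_comp_in_M21, blast)

text \<open>Multiplicativity uses that a completion fixes \<open>0{0,1}\<^sup>\<omega>\<close> pointwise: once a computation started in
  \<open>1{0,1}\<^sup>\<omega>\<close> falls into \<open>0{0,1}\<^sup>\<omega>\<close>, that is, becomes undefined under \<open>\<rho>\<close>, it stays there.\<close>

lemma rho_M_comp:
  assumes F: "F \<in> F0" and G: "G \<in> F0"
  shows "rho (M_comp F G) = M_comp (rho F) (rho G)"
proof (rule rho_eqI)
  note F' = F0_D[OF F] and G' = F0_D[OF G]
  note rF = rho_in_M21_and_act[OF F'(1)] and rG = rho_in_M21_and_act[OF G'(1)]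
  show "M_comp F G \<in> M21" "M_comp (rho F) (rho G) \<in> M21"
    using F' G' rF rG M_comp_in_M21 by blast+
  fix z y
  have "(\<exists>z'. act G (True ## z) = Some z' \<and> act F z' = Some (True ## y)) \<longleftrightarrow>
      (\<exists>z'. act G (True ## z) = Some (True ## z') \<and> act F (True ## z') = Some (True ## y))"
  proof
    assume "\<exists>z'. act G (True ## z) = Some z' \<and> act F z' = Some (True ## y)"
    then obtain z' where z': "act G (True ## z) = Some z'" "act F z' = Some (True ## y)" by blast
    obtain b t where bt: "z' = b ## t" by (cases z')
    then have b using z'(2) F'(2)[of t] by (cases b) auto
    then show "\<exists>z'. act G (True ## z) = Some (True ## z') \<and> act F (True ## z') = Some (True ## y)"
      using z' bt by auto
  qed blast
  then show "act (M_comp (rho F) (rho G)) z = Some y \<longleftrightarrow>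
      act (M_comp F G) (True ## z) = Some (True ## y)"
    using rF rG F' G' by (simp add: act_M_comp)
qed

text \<open>In \<open>1x\<close> the bits of \<open>x\<close> are shifted by one position, so \<open>\<tau>\<^sub>i\<^sub>+\<^sub>1\<^sub>,\<^sub>j\<^sub>+\<^sub>1\<close> leaves the leading 1 alone
  and acts on \<open>x\<close> as \<open>\<tau>\<^sub>i\<^sub>,\<^sub>j\<close>.\<close>

lemma F0_rho_tau:
  assumes ij: "1 \<le> i" "i < j" and F: "F \<in> M21"
    and zero: "\<And>x. act F (False ## x) = Some (False ## x)"
    and one: "\<And>x. act F (True ## x) = act (tau (i + 1) (j + 1)) (True ## x)"
  shows "F \<in> F0" "rho F = tau i j"
proof -
  show "F \<in> F0"
  proof (rule F0_I[OF F zero])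
    fix z
    show "\<exists>y. act F (True ## z) = Some y"
      unfolding one using ij by (metis act_tau_total act_tau_Suc)
  qed
  show "rho F = tau i j"
  proof (rule rho_eqI[OF F tau_in_M21[OF ij]])
    fix z y
    obtain y' where y': "act (tau i j) z = Some y'" using act_tau_total[OF ij] .
    then show "act (tau i j) z = Some y \<longleftrightarrow> act F (True ## z) = Some (True ## y)"
      unfolding one using act_tau_Suc[OF ij y'] by simp
  qed
qed

section \<open>Evaluation of words\<close>

lemma M_comp_assoc:
  assumes "F \<in> M21" "G \<in> M21" "H \<in> M21"
  shows "M_comp (M_comp F G) H = M_comp F (M_comp G H)"
  using assms by (intro M21_eqI) (auto simp: M_comp_in_M21 act_M_comp)

lemma M_comp_M_one_left: "F \<in> M21 \<Longrightarrow> M_comp M_one F = F"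
  by (rule M21_eqI) (auto simp: M_comp_in_M21 act_M_comp M_one_in_M21 act_M_one)

lemma E_Nil: "E [] = M_one" and E_Cons: "E (a # w) = M_comp (letter_elem a) (E w)"
  by (simp_all add: E_def M_prod_def)

lemma letter_elem_in_M21: "\<Gamma> \<subseteq> M21 \<Longrightarrow> a \<in> letters \<Gamma> \<Longrightarrow> letter_elem a \<in> M21"
  by (auto simp: letters_def tau_in_M21)

lemma E_in_M21: "\<Gamma> \<subseteq> M21 \<Longrightarrow> w \<in> lists (letters \<Gamma>) \<Longrightarrow> E w \<in> M21"
  by (induction w) (auto simp: E_Nil E_Cons M_one_in_M21 M_comp_in_M21 letter_elem_in_M21)

lemma E_append:
  assumes "\<Gamma> \<subseteq> M21" "v \<in> lists (letters \<Gamma>)" "w \<in> lists (letters \<Gamma>)"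
  shows "E (v @ w) = M_comp (E v) (E w)"
  using assms(2) by (induction v)
    (use assms in \<open>auto simp: E_Nil E_Cons M_comp_M_one_left M_comp_assoc E_in_M21 letter_elem_in_M21\<close>)

text \<open>Only completions of single letters are needed, because \<open>F0\<close> is closed under products and \<open>\<rho>\<close> is
  multiplicative on it.\<close>

lemma complete_word_correct:
  assumes \<Delta>: "\<Delta> \<subseteq> M21"
    and word: "\<And>a. a \<in> letters \<Gamma> \<Longrightarrow> complete_letter bg bt a \<in> lists (letters \<Delta>)"
    and compl: "\<And>a. a \<in> letters \<Gamma> \<Longrightarrow> E (complete_letter bg bt a) \<in> completions (letter_elem a)"
    and w: "w \<in> lists (letters \<Gamma>)"
  shows "complete_word bg bt w \<in> lists (letters \<Delta>)"
    and "E (complete_word bg bt w) = M_prod (map (\<lambda>a. E (complete_letter bg bt a)) w)"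
    and "E (complete_word bg bt w) \<in> completions (E w)"
proof -
  have "complete_word bg bt w \<in> lists (letters \<Delta>) \<and>
    E (complete_word bg bt w) = M_prod (map (\<lambda>a. E (complete_letter bg bt a)) w) \<and>
    E (complete_word bg bt w) \<in> completions (E w)"
    using w
  proof (induction w)
    case Nil
    then show ?case by (simp add: complete_word_def E_Nil M_prod_def completions_def M_one_in_F0 rho_M_one)
  next
    case (Cons a w)
    then have a: "a \<in> letters \<Gamma>" and w: "w \<in> lists (letters \<Gamma>)" by auto
    note IH = Cons.IH
    have split: "complete_word bg bt (a # w) = complete_letter bg bt a @ complete_word bg bt w"
      by (simp add: complete_word_def)
    have "E (complete_word bg bt (a # w)) =
        M_comp (E (complete_letter bg bt a)) (E (complete_word bg bt w))"
      unfolding split using E_append[OF \<Delta> word[OF a]] IH by blast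
    then show ?case
      using IH word[OF a] compl[OF a] unfolding split
      by (auto simp: completions_def M_comp_in_F0 rho_M_comp E_Cons M_prod_def)
  qed
  then show "complete_word bg bt w \<in> lists (letters \<Delta>)"
    and "E (complete_word bg bt w) = M_prod (map (\<lambda>a. E (complete_letter bg bt a)) w)"
    and "E (complete_word bg bt w) \<in> completions (E w)" by blast+
qed

section \<open>Bounded runs\<close>

definition bounded_step ::
    "('a, 'b) transducer \<Rightarrow> 'a list \<Rightarrow> nat \<Rightarrow> 'b config \<Rightarrow> 'b config \<Rightarrow> bool" where
  "bounded_step T x B C C' \<longleftrightarrow> step T x C = Some C' \<and> work_pos C < B \<and> work_pos C' < B"

abbreviation bounded_run ::
    "('a, 'b) transducer \<Rightarrow> 'a list \<Rightarrow> nat \<Rightarrow> 'b config \<Rightarrow> 'b config \<Rightarrow> bool" where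
  "bounded_run T x B \<equiv> (bounded_step T x B)\<^sup>*\<^sup>*"

lemma bounded_run_reaches: "bounded_run T x B (init_config T) C \<Longrightarrow> reaches T x C"
  unfolding reaches_def
  by (rule mono_rtranclp[rule_format, of "bounded_step T x B"]) (auto simp: bounded_step_def)

text \<open>Machines are deterministic, so every reachable configuration lies on the run that leads to the
  halting configuration. A space bound along this one run is therefore a bound for all of them.\<close>

lemma bounded_run_bounds_reachable:
  assumes run: "bounded_run T x B (init_config T) C" and halt: "step T x C = None"
    and B: "0 < B" and D: "reaches T x D"
  shows "work_pos D < B"
proof -
  have "bounded_run T x B D C \<and> work_pos D < B"
    using D unfolding reaches_def
  proof (induction rule: rtranclp_induct)
    case base
    then show ?case using run B by (simp add: init_config_def)
  next
    case (step D D')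
    from step.hyps(2) have "D \<noteq> C" using halt by auto
    from step.IH have "bounded_run T x B D C" ..
    then obtain D'' where D'': "bounded_step T x B D D''" "bounded_run T x B D'' C"
      by (cases rule: converse_rtranclpE) (use \<open>D \<noteq> C\<close> in auto)
    have "D'' = D'" "work_pos D'' < B" using D''(1) step.hyps(2) by (simp_all add: bounded_step_def)
    then show ?case using D''(2) by blast
  qed
  then show ?thesis ..
qed

section \<open>The completing machine\<close>

text \<open>On input \<open>w\<close> the machine below runs a given machine \<open>T\<close> on each block \<open>a\<^sup>i b\<^sup>j\<^sup>-\<^sup>i\<close> of the input in
  turn. The block has no end markers of its own, and its neighbours may be letters of adjacent
  blocks, so the virtual symbol scanned by \<open>T\<close> has to be inferred. Its shape makes this possible
  with finite memory: stepping left from an \<open>a\<close> stays in the block iff the new symbol is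
  an \<open>a\<close>, stepping right from a \<open>b\<close> iff it is a \<open>b\<close>, and every other step from a letter stays inside. The left neighbour of a
  block is never \<open>a\<close> and the right neighbour is never \<open>b\<close>.

  A mode records which of these situations applies: the head is known to be on a virtual end
  marker (\<open>At_left\<close>, \<open>At_right\<close>), it has just stepped left from an \<open>a\<close> (\<open>Backing\<close>) or right from a \<open>b\<close>
  (\<open>Leaving\<close>), or it is known to be on a letter of the block (\<open>Inside\<close>).\<close>

datatype mode = At_left | At_right | Backing | Leaving | Inside

text \<open>The values \<^const>\<open>Left_end\<close> for foreign symbols in mode \<^const>\<open>Inside\<close> are arbitrary; that combination does
  not arise in a run.\<close>

fun view :: "mode \<Rightarrow> symb scanned \<Rightarrow> symb scanned" where
  "view At_left s = Left_end"
| "view At_right s = Right_end"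
| "view Backing s = (if s = Inp Sa then Inp Sa else Left_end)"
| "view Leaving s = (if s = Inp Sb then Inp Sb else Right_end)"
| "view Inside s = (if s = Inp Sa \<or> s = Inp Sb then s else Left_end)"

fun next_mode :: "symb scanned \<Rightarrow> dir \<Rightarrow> mode" where
  "next_mode Left_end d = (if d = Go_right then Inside else At_left)"
| "next_mode Right_end d = (if d = Go_left then Inside else At_right)"
| "next_mode (Inp s) d =
     (if s = Sa \<and> d = Go_left then Backing else if s = Sb \<and> d = Go_right then Leaving else Inside)"

text \<open>On its own tape \<open>T\<close> is stopped by the end markers; here the head must be held back explicitly, or
  it would wander off into the neighbouring blocks.\<close>

definition clamp_dir :: "symb scanned \<Rightarrow> dir \<Rightarrow> dir" where
  "clamp_dir v d = (if v = Left_end \<and> d = Go_left \<or> v = Right_end \<and> d = Go_right then Stay else d)"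

datatype phase = Dispatch | Sim nat mode | Skip_as | Skip_bs | Seek_fresh | Erase

instance mode :: countable by countable_datatype
instance phase :: countable by countable_datatype

text \<open>A generator from \<open>\<Gamma>\<close> is completed by one emission. A block is handled by simulating \<open>T\<close> from the
  position to its left, moving the input head behind the block (\<open>Skip_as\<close>, \<open>Skip_bs\<close>), and clearing the
  work tape for the next block.

  The work tape has no end marker either. A visited cell with content \<open>c\<close> holds \<open>Suc c\<close> and a fresh cell
  holds 0. As the head moves by single cells, the visited ones form an initial segment. To clear it, the head goes to the first
  fresh cell (\<open>Seek_fresh\<close>) and then erases cells while moving left (\<open>Erase\<close>). Since a left move from
  cell 0 has no effect, cell 0 is recognised as the one where the head reads the 0 that it has just
  written.\<close>

fun phase_trans :: "(symb, symb) transducer \<Rightarrow> (elem \<Rightarrow> letter list) \<Rightarrow> phase \<Rightarrow> symb scanned \<Rightarrow> nat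
    \<Rightarrow> (phase \<times> nat \<times> dir \<times> dir \<times> symb list) option" where
  "phase_trans T bg Dispatch s c = (case s of
      Left_end \<Rightarrow> Some (Dispatch, c, Go_right, Stay, [])
    | Inp (Sgen \<gamma>) \<Rightarrow> Some (Dispatch, c, Go_right, Stay, enc (bg \<gamma>))
    | Inp Sa \<Rightarrow> Some (Sim (start T) At_left, c, Go_left, Stay, [])
    | _ \<Rightarrow> None)"
| "phase_trans T bg (Sim q mo) s c = (let v = view mo s in
     case trans T q v (case c of 0 \<Rightarrow> blank T | Suc c' \<Rightarrow> c') of
       Some (q', c', d, e, out) \<Rightarrow> Some (Sim q' (next_mode v d), Suc c', clamp_dir v d, e, out)
     | None \<Rightarrow> Some (if v = Left_end \<or> v = Inp Sa then Skip_as else Skip_bs, c,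
                     if v = Left_end then Go_right else Stay, Stay, []))"
| "phase_trans T bg Skip_as s c =
     (if s = Inp Sa then Some (Skip_as, c, Go_right, Stay, []) else Some (Skip_bs, c, Stay, Stay, []))"
| "phase_trans T bg Skip_bs s c =
     (if s = Inp Sb then Some (Skip_bs, c, Go_right, Stay, []) else Some (Seek_fresh, c, Stay, Stay, []))"
| "phase_trans T bg Seek_fresh s c =
     (if c = 0 then Some (Erase, c, Stay, Go_left, []) else Some (Seek_fresh, c, Stay, Go_right, []))"
| "phase_trans T bg Erase s c =
     (if c = 0 then Some (Dispatch, 0, Stay, Stay, []) else Some (Erase, 0, Stay, Go_left, []))"

definition completer :: "(symb, symb) transducer \<Rightarrow> (elem \<Rightarrow> letter list) \<Rightarrow> (symb, symb) transducer" where
  "completer T bg = \<lparr>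
     states = to_nat ` ({Dispatch, Skip_as, Skip_bs, Seek_fresh, Erase}
                          \<union> (\<lambda>(q, mo). Sim q mo) ` (states T \<times> UNIV)),
     start = to_nat Dispatch,
     work_symbs = insert 0 (Suc ` work_symbs T),
     blank = 0,
     trans = (\<lambda>q s c. map_option (\<lambda>(ph, r). (to_nat ph, r)) (phase_trans T bg (from_nat q) s c))\<rparr>"

instance mode :: finite
proof
  have "(UNIV :: mode set) \<subseteq> {At_left, At_right, Backing, Leaving, Inside}"
    by (auto intro: mode.exhaust)
  then show "finite (UNIV :: mode set)" by (rule finite_subset) simp
qed

lemma symbs_enc:
  assumes "w \<in> lists (letters \<Gamma>)" shows "set (enc w) \<subseteq> symbs \<Gamma>"
  using assms by (induction w) (fastforce simp: enc_def letters_def symbs_def)+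

text \<open>The words for the generators from \<open>\<Gamma>\<close> are stored in the transition function; as \<open>\<Gamma>\<close> is finite, the
  machine is still a finite object.\<close>

lemma completer_transducer_over:
  assumes T: "transducer_over (symbs {}) (symbs \<Delta>) T" and fin: "finite \<Gamma>" "finite \<Delta>"
    and bg: "\<And>\<gamma>. \<gamma> \<in> \<Gamma> \<Longrightarrow> bg \<gamma> \<in> lists (letters \<Delta>)"
  shows "transducer_over (symbs \<Gamma>) (symbs \<Delta>) (completer T bg)"
proof -
  let ?M = "completer T bg"
  have "start T \<in> states T \<and> blank T \<in> work_symbs T \<and> finite (states T) \<and> finite (work_symbs T)"
    using T unfolding transducer_over_def by (elim conjE) (intro conjI)
  then have start: "start T \<in> states T" "blank T \<in> work_symbs T"
    and finT: "finite (states T)" "finite (work_symbs T)" by simp_all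
  have bg': "set (enc (bg \<gamma>)) \<subseteq> symbs \<Delta>" if "\<gamma> \<in> \<Gamma>" for \<gamma> by (rule symbs_enc[OF bg[OF that]])
  have "to_nat ph' \<in> states ?M \<and> c' \<in> work_symbs ?M \<and> set out \<subseteq> symbs \<Delta>"
    if ph: "to_nat ph \<in> states ?M" and s: "s \<in> insert Left_end (insert Right_end (Inp ` symbs \<Gamma>))"
      and c: "c \<in> work_symbs ?M" and tr: "phase_trans T bg ph s c = Some (ph', c', d, e, out)"
    for ph s c ph' c' d e out
  proof (cases ph)
    case Dispatch
    consider "s = Left_end" | "s = Right_end" | \<gamma> where "s = Inp (Sgen \<gamma>)" "\<gamma> \<in> \<Gamma>"
      | "s = Inp Sa" | "s = Inp Sb" using s by (auto simp: symbs_def)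
    then show ?thesis
    proof cases
      case (3 \<gamma>)
      then show ?thesis using tr c bg'[OF 3(2)] unfolding Dispatch by (auto simp: completer_def)
    qed (use tr c start in \<open>auto simp: Dispatch completer_def\<close>)
  next
    case (Sim q mo)
    have q: "q \<in> states T" using ph unfolding Sim by (auto simp: completer_def)
    let ?v = "view mo s" and ?c = "case c of 0 \<Rightarrow> blank T | Suc c' \<Rightarrow> c'"
    have v: "?v \<in> insert Left_end (insert Right_end (Inp ` symbs {}))"
      by (cases mo) (auto simp: symbs_def)
    have c0: "?c \<in> work_symbs T"
      using c start by (auto simp: completer_def split: nat.splits)
    show ?thesis
    proof (cases "trans T q ?v ?c")
      case None
      then show ?thesis using tr c unfolding Sim by (auto simp: completer_def Let_def split: if_splits)
    next
      case (Some r)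
      obtain q' c'' d' e' out' where r: "r = (q', c'', d', e', out')" by (cases r)
      have "q' \<in> states T \<and> c'' \<in> work_symbs T \<and> set out' \<subseteq> symbs \<Delta>"
      proof -
        from T have "\<forall>q\<in>states T. \<forall>s\<in>insert Left_end (insert Right_end (Inp ` symbs {})). \<forall>c\<in>work_symbs T.
          \<forall>q' c' d e out. trans T q s c = Some (q', c', d, e, out) \<longrightarrow>
            q' \<in> states T \<and> c' \<in> work_symbs T \<and> set out \<subseteq> symbs \<Delta>"
          unfolding transducer_over_def by (elim conjE)
        from this[rule_format, OF q v c0] Some show ?thesis unfolding r by simp
      qed
      then show ?thesis using tr Some unfolding Sim r by (auto simp: completer_def Let_def)
    qed
  qed (use tr c in \<open>auto simp: completer_def split: if_splits\<close>)
  note key = this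
  have "q' \<in> states ?M \<and> c' \<in> work_symbs ?M \<and> set out \<subseteq> symbs \<Delta>"
    if q: "q \<in> states ?M" and s: "s \<in> insert Left_end (insert Right_end (Inp ` symbs \<Gamma>))"
      and c: "c \<in> work_symbs ?M" and tr: "trans ?M q s c = Some (q', c', d, e, out)" for q s c q' c' d e out
  proof -
    have "q \<in> range (to_nat :: phase \<Rightarrow> nat)" using q by (auto simp: completer_def)
    then obtain ph :: phase where ph: "q = to_nat ph" by blast
    obtain ph' where ph': "phase_trans T bg ph s c = Some (ph', c', d, e, out)" "q' = to_nat ph'"
      using tr unfolding ph by (auto simp: completer_def)
    show ?thesis using key[OF q[unfolded ph] s c ph'(1)] unfolding ph'(2) .
  qed
  note closed = this
  have "\<forall>q\<in>states ?M. \<forall>s\<in>insert Left_end (insert Right_end (Inp ` symbs \<Gamma>)). \<forall>c\<in>work_symbs ?M.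
      \<forall>q' c' d e out. trans ?M q s c = Some (q', c', d, e, out) \<longrightarrow>
        q' \<in> states ?M \<and> c' \<in> work_symbs ?M \<and> set out \<subseteq> symbs \<Delta>"
    by (intro ballI allI impI) (rule closed)
  moreover have "finite (states ?M)" "finite (work_symbs ?M)"
    using finT by (simp_all add: completer_def)
  moreover have "finite (symbs \<Gamma>)" "finite (symbs \<Delta>)" using fin by (simp_all add: symbs_def)
  moreover have "start ?M \<in> states ?M" "blank ?M \<in> work_symbs ?M" by (simp_all add: completer_def)
  ultimately show ?thesis unfolding transducer_over_def by (intro conjI)
qed

abbreviation cfg :: "phase \<Rightarrow> nat \<Rightarrow> (nat \<Rightarrow> nat) \<Rightarrow> nat \<Rightarrow> symb list \<Rightarrow> symb config" where
  "cfg ph p wk h out \<equiv>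
     \<lparr>cstate = to_nat ph, in_pos = p, work = wk, work_pos = h, written = out\<rparr>"

lemma step_completer:
  assumes "phase_trans T bg ph (scan x p) (wk h) = Some (ph', c, d, e, out')"
  shows "step (completer T bg) x (cfg ph p wk h out) =
    Some (cfg ph' (min (move d p) (length x + 1)) (wk(h := c)) (move e h) (out @ out'))"
  using assms by (simp add: step_def completer_def)

lemma bounded_step_completer:
  assumes "phase_trans T bg ph (scan x p) (wk h) = Some (ph', c, d, e, out')"
    and "h < B" "move e h < B"
    and "p' = min (move d p) (length x + 1)" "wk' = wk(h := c)" "h' = move e h" "out'' = out @ out'"
  shows "bounded_step (completer T bg) x B (cfg ph p wk h out) (cfg ph' p' wk' h' out'')"
  using assms step_completer[of T bg ph x p wk h, OF assms(1)] by (simp add: bounded_step_def)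

section \<open>Cleaning the work tape\<close>

lemma run_erase:
  assumes "\<forall>p\<le>h. wk p \<noteq> 0" "\<forall>p>h. wk p = 0" "h < B" "p \<le> length x + 1"
  shows "bounded_run (completer T bg) x B (cfg Erase p wk h out) (cfg Dispatch p (\<lambda>_. 0) 0 out)"
  using assms
proof (induction h arbitrary: wk)
  case 0
  have wk: "wk(0 := 0) = (\<lambda>_. 0)" using 0 by auto
  have "bounded_step (completer T bg) x B (cfg Erase p wk 0 out) (cfg Erase p (\<lambda>_. 0) 0 out)"
    by (rule bounded_step_completer[where e = Go_left]) (use 0 wk in auto)
  moreover have "bounded_step (completer T bg) x B (cfg Erase p (\<lambda>_. 0) 0 out) (cfg Dispatch p (\<lambda>_. 0) 0 out)"
    by (rule bounded_step_completer) (use 0 in auto)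
  ultimately show ?case by (meson converse_rtranclp_into_rtranclp rtranclp.rtrancl_refl)
next
  case (Suc h)
  have "bounded_step (completer T bg) x B (cfg Erase p wk (Suc h) out) (cfg Erase p (wk(Suc h := 0)) h out)"
    by (rule bounded_step_completer[where e = Go_left]) (use Suc.prems in auto)
  moreover have "bounded_run (completer T bg) x B (cfg Erase p (wk(Suc h := 0)) h out)
      (cfg Dispatch p (\<lambda>_. 0) 0 out)"
    by (rule Suc.IH) (use Suc.prems in \<open>auto simp: less_Suc_eq_le le_Suc_eq not_le dest: Suc_lessI\<close>)
  ultimately show ?case by (rule converse_rtranclp_into_rtranclp)
qed

lemma run_seek_fresh:
  assumes "\<forall>p. wk p = 0 \<longleftrightarrow> m \<le> p" "h \<le> m" "m < B" "p \<le> length x + 1"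
  shows "bounded_run (completer T bg) x B (cfg Seek_fresh p wk h out) (cfg Seek_fresh p wk m out)"
  using assms(2)
proof (induction h rule: inc_induct)
  case (step h)
  have "bounded_step (completer T bg) x B (cfg Seek_fresh p wk h out) (cfg Seek_fresh p wk (Suc h) out)"
    by (rule bounded_step_completer[where e = Go_right]) (use step assms in auto)
  then show ?case using step.IH by (rule converse_rtranclp_into_rtranclp)
qed simp

lemma run_clean:
  assumes wk: "\<forall>p. wk p = 0 \<longleftrightarrow> m \<le> p" and h: "h \<le> m" and m: "m < B" and p: "p \<le> length x + 1"
  shows "bounded_run (completer T bg) x B (cfg Seek_fresh p wk h out) (cfg Dispatch p (\<lambda>_. 0) 0 out)"
proof -
  note run_seek_fresh[OF assms, of T bg out]
  also have "bounded_step (completer T bg) x B (cfg Seek_fresh p wk m out) (cfg Erase p wk (m - 1) out)"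
    by (rule bounded_step_completer[where e = Go_left]) (use assms in auto)
  also have "bounded_run (completer T bg) x B (cfg Erase p wk (m - 1) out) (cfg Dispatch p (\<lambda>_. 0) 0 out)"
  proof (cases m)
    case 0
    then have "wk = (\<lambda>_. 0)" using wk by auto
    then have "bounded_step (completer T bg) x B (cfg Erase p wk (m - 1) out) (cfg Dispatch p (\<lambda>_. 0) 0 out)"
      by (intro bounded_step_completer) (use 0 m p in auto)
    then show ?thesis by (rule r_into_rtranclp)
  next
    case (Suc m')
    then show ?thesis by (intro run_erase) (use wk m p in auto)
  qed
  finally show ?thesis .
qed

section \<open>Simulation on a block of the input\<close>

abbreviation block :: "nat \<Rightarrow> nat \<Rightarrow> symb list" where
  "block i k \<equiv> replicate i Sa @ replicate k Sb"

lemma scan_block: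
  "scan (block i k) p = (if p = 0 then Left_end else if p \<le> i then Inp Sa
     else if p \<le> i + k then Inp Sb else Right_end)"
  by (auto simp: scan_def nth_append)

lemma scan_in_context:
  assumes "1 \<le> p" "p \<le> length ys" shows "scan (xs @ ys @ zs) (length xs + p) = Inp (ys ! (p - 1))"
proof -
  obtain q where "p = Suc q" using assms(1) by (cases p) auto
  then show ?thesis using assms(2) by (simp add: scan_def nth_append)
qed

lemma scan_before: "scan (xs @ ys) (length xs) = (if xs = [] then Left_end else Inp (last xs))"
  by (auto simp: scan_def nth_append last_conv_nth)

lemma scan_after: "scan (xs @ ys) (length xs + 1) = (if ys = [] then Right_end else Inp (hd ys))"
  by (auto simp: scan_def nth_append hd_conv_nth Suc_le_eq)

locale block_in_context =
  fixes pre post :: "symb list" and i k :: nat and x :: "symb list"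
  assumes i: "1 \<le> i" and k: "1 \<le> k" and x: "x = pre @ block i k @ post"
    and pre: "pre = [] \<or> last pre \<noteq> Sa" and post: "post = [] \<or> hd post \<noteq> Sb"
begin

lemma scan_a: "1 \<le> p \<Longrightarrow> p \<le> i \<Longrightarrow> scan x (length pre + p) = Inp Sa"
  unfolding x by (subst scan_in_context) (auto simp: nth_append)

lemma scan_b: "i < p \<Longrightarrow> p \<le> i + k \<Longrightarrow> scan x (length pre + p) = Inp Sb"
  unfolding x by (subst scan_in_context) (auto simp: nth_append)

lemma scan_left: "scan x (length pre) \<noteq> Inp Sa"
  unfolding x scan_before using pre by auto

lemma scan_right: "scan x (length pre + (i + k + 1)) \<noteq> Inp Sb"
  using scan_after[of "pre @ block i k" post] post unfolding x by (auto simp: add.assoc)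

lemma in_range: "p \<le> i + k + 1 \<Longrightarrow> length pre + p \<le> length x + 1"
  unfolding x by simp

text \<open>The mode is maintained correctly: it lets the machine see on the real tape what \<open>T\<close> sees at the
  corresponding position \<open>p\<close> of the isolated block, and the real head follows the virtual one.\<close>

lemma view_next_mode:
  assumes p: "p \<le> i + k + 1" and p': "p' = min (move d p) (i + k + 1)"
    and v: "v = scan (block i k) p"
  shows "view (next_mode v d) (scan x (length pre + p')) = scan (block i k) p'"
    and "min (move (clamp_dir v d) (length pre + p)) (length x + 1) = length pre + p'"
proof -
  consider "p = 0" | "1 \<le> p" "p \<le> i" | "i < p" "p \<le> i + k" | "p = i + k + 1" using p by linarith
  note cs = this
  show "view (next_mode v d) (scan x (length pre + p')) = scan (block i k) p'"
    using cs
  proof cases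
    case 1
    then show ?thesis using p' v i scan_a[of 1] by (cases d) (auto simp: scan_block)
  next
    case 2
    show ?thesis
    proof (cases d)
      case Go_left
      then show ?thesis using 2 p' v scan_a[of p'] scan_left k
        by (cases "p' = 0") (auto simp: scan_block)
    next
      case Stay
      then show ?thesis using 2 p' v scan_a[of p'] k by (auto simp: scan_block)
    next
      case Go_right
      then show ?thesis using 2 p' v scan_a[of p'] scan_b[of p'] k
        by (cases "p' \<le> i") (auto simp: scan_block)
    qed
  next
    case 3
    show ?thesis
    proof (cases d)
      case Go_left
      then have "1 \<le> p'" "p' \<le> i + k" using 3 i p' by auto
      then show ?thesis using Go_left 3 v scan_a[of p'] scan_b[of p']
        by (cases "p' \<le> i") (auto simp: scan_block)
    next
      case Stay
      then show ?thesis using 3 p' v scan_b[of p'] by (auto simp: scan_block)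
    next
      case Go_right
      then have "p' = p + 1" using 3 p' by simp
      then show ?thesis using Go_right 3 v scan_b[of p'] scan_right
        by (cases "p' \<le> i + k") (auto simp: scan_block not_le dest: antisym)
    qed
  next
    case 4
    then show ?thesis using p' v k scan_b[of "i + k"] by (cases d) (auto simp: scan_block)
  qed
  show "min (move (clamp_dir v d) (length pre + p)) (length x + 1) = length pre + p'"
    using cs by cases (use p' v k i in_range[of p] in
      \<open>cases d; auto simp: clamp_dir_def scan_block x\<close>)+
qed

lemma run_skip_as:
  assumes "1 \<le> p" "p \<le> i + 1" "h < B"
  shows "bounded_run (completer T bg) x B (cfg Skip_as (length pre + p) wk h out)
           (cfg Skip_bs (length pre + (i + 1)) wk h out)"
  using assms(2,1)
proof (induction p rule: inc_induct)
  case base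
  have "bounded_step (completer T bg) x B (cfg Skip_as (length pre + (i + 1)) wk h out)
           (cfg Skip_bs (length pre + (i + 1)) wk h out)"
    by (rule bounded_step_completer[where d = Stay and e = Stay])
      (use scan_b[of "i + 1"] k in_range[of "i + 1"] assms(3) in auto)
  then show ?case by (rule r_into_rtranclp)
next
  case (step p)
  have "bounded_step (completer T bg) x B (cfg Skip_as (length pre + p) wk h out)
           (cfg Skip_as (length pre + Suc p) wk h out)"
    by (rule bounded_step_completer[where d = Go_right and e = Stay])
      (use scan_a[of p] step in_range[of "Suc p"] assms(3) in auto)
  then show ?case using step by (meson converse_rtranclp_into_rtranclp le_SucI)
qed

lemma run_skip_bs:
  assumes "i + 1 \<le> p" "p \<le> i + k + 1" "h < B"
  shows "bounded_run (completer T bg) x B (cfg Skip_bs (length pre + p) wk h out)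
           (cfg Seek_fresh (length pre + (i + k + 1)) wk h out)"
  using assms(2,1)
proof (induction p rule: inc_induct)
  case base
  have "bounded_step (completer T bg) x B (cfg Skip_bs (length pre + (i + k + 1)) wk h out)
           (cfg Seek_fresh (length pre + (i + k + 1)) wk h out)"
    by (rule bounded_step_completer[where d = Stay and e = Stay])
      (use scan_right in_range[of "i + k + 1"] assms(3) in auto)
  then show ?case by (rule r_into_rtranclp)
next
  case (step p)
  have "bounded_step (completer T bg) x B (cfg Skip_bs (length pre + p) wk h out)
           (cfg Skip_bs (length pre + Suc p) wk h out)"
    by (rule bounded_step_completer[where d = Go_right and e = Stay])
      (use scan_b[of p] step in_range[of "Suc p"] assms(3) in auto)
  then show ?case using step by (meson converse_rtranclp_into_rtranclp le_SucI)
qed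

text \<open>The simulation invariant. The real head positions are those of \<open>T\<close>, shifted on the input tape by
  the length of \<open>pre\<close>; the first \<open>m\<close> work cells have been visited. As \<open>m\<close> is at most one
  more than the largest position reached by \<open>T\<close>, it is bounded by the space \<open>K\<close> of \<open>T\<close>. One further
  cell is reserved for the later search for a fresh cell.\<close>

lemma run_simulation:
  assumes run: "reaches T (block i k) C"
    and bound: "\<And>C. reaches T (block i k) C \<Longrightarrow> work_pos C + 1 \<le> K"
  shows "\<exists>mo m. bounded_run (completer T bg) x (K + 1)
       (cfg (Sim (start T) At_left) (length pre) (\<lambda>_. 0) 0 out)
       (cfg (Sim (cstate C) mo) (length pre + in_pos C) (\<lambda>p. if p < m then Suc (work C p) else 0)
          (work_pos C) (out @ written C))
     \<and> view mo (scan x (length pre + in_pos C)) = scan (block i k) (in_pos C)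
     \<and> in_pos C \<le> i + k + 1 \<and> (\<forall>p\<ge>m. work C p = blank T) \<and> work_pos C \<le> m \<and> m \<le> K"
  using run[unfolded reaches_def]
proof (induction rule: rtranclp_induct)
  case base
  show ?case
    by (intro exI[of _ At_left] exI[of _ 0]) (simp add: init_config_def scan_block)
next
  case (step C C')
  let ?M = "completer T bg"
  obtain mo m where IH: "bounded_run ?M x (K + 1)
       (cfg (Sim (start T) At_left) (length pre) (\<lambda>_. 0) 0 out)
       (cfg (Sim (cstate C) mo) (length pre + in_pos C) (\<lambda>p. if p < m then Suc (work C p) else 0)
          (work_pos C) (out @ written C))"
     and vw: "view mo (scan x (length pre + in_pos C)) = scan (block i k) (in_pos C)"
     and p: "in_pos C \<le> i + k + 1" and blank: "\<forall>p\<ge>m. work C p = blank T"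
     and h: "work_pos C \<le> m" and m: "m \<le> K"
    using step.IH by blast
  let ?wk = "\<lambda>p. if p < m then Suc (work C p) else 0" and ?v = "scan (block i k) (in_pos C)"
  have "reaches T (block i k) C" "reaches T (block i k) C'"
    using step.hyps unfolding reaches_def by (auto intro: rtranclp.rtrancl_into_rtrancl)
  note K = bound[OF this(1)] bound[OF this(2)]
  have scanned: "(case ?wk (work_pos C) of 0 \<Rightarrow> blank T | Suc c \<Rightarrow> c) = work C (work_pos C)"
    using blank by auto
  obtain q c d e out' where tr: "trans T (cstate C) ?v (work C (work_pos C)) = Some (q, c, d, e, out')"
    and C': "C' = \<lparr>cstate = q, in_pos = min (move d (in_pos C)) (length (block i k) + 1),
      work = (work C)(work_pos C := c), work_pos = move e (work_pos C), written = written C @ out'\<rparr>"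
    using step.hyps(2) unfolding step_def by (auto split: option.splits)
  \<comment> \<open>the cell just rewritten counts as visited from now on\<close>
  define m' where "m' = max m (work_pos C + 1)"
  define p' where "p' = min (move d (in_pos C)) (i + k + 1)"
  have p'C: "in_pos C' = p'" unfolding C' p'_def by simp
  note nm = view_next_mode[OF p p'_def refl]
  have "bounded_step ?M x (K + 1)
       (cfg (Sim (cstate C) mo) (length pre + in_pos C) ?wk (work_pos C) (out @ written C))
       (cfg (Sim (cstate C') (next_mode ?v d)) (length pre + in_pos C')
          (\<lambda>p. if p < m' then Suc (work C' p) else 0) (work_pos C') (out @ written C'))"
  proof (rule bounded_step_completer)
    show "phase_trans T bg (Sim (cstate C) mo) (scan x (length pre + in_pos C)) (?wk (work_pos C)) =
      Some (Sim (cstate C') (next_mode ?v d), Suc c, clamp_dir ?v d, e, out')"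
      using tr by (simp only: phase_trans.simps Let_def vw scanned) (simp add: C')
    show "(\<lambda>p. if p < m' then Suc (work C' p) else 0) = ?wk(work_pos C := Suc c)"
      using h by (auto simp: m'_def C' fun_eq_iff)
  qed (use K nm(2) p'C in \<open>auto simp: C'\<close>)
  with IH have "bounded_run ?M x (K + 1)
       (cfg (Sim (start T) At_left) (length pre) (\<lambda>_. 0) 0 out)
       (cfg (Sim (cstate C') (next_mode ?v d)) (length pre + in_pos C')
          (\<lambda>p. if p < m' then Suc (work C' p) else 0) (work_pos C') (out @ written C'))"
    by (rule rtranclp.rtrancl_into_rtrancl)
  moreover have "move e (work_pos C) \<le> m'" using h by (cases e) (auto simp: m'_def)
  then have "work_pos C' \<le> m'" by (simp add: C')
  moreover have "m' \<le> K" using m K by (simp add: m'_def)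
  moreover have "\<forall>p\<ge>m'. work C' p = blank T" using blank by (auto simp: m'_def C')
  moreover have "in_pos C' \<le> i + k + 1" by (simp add: p'C p'_def)
  moreover have "view (next_mode ?v d) (scan x (length pre + in_pos C')) = scan (block i k) (in_pos C')"
    using nm(1) p'C by simp
  ultimately show ?case by blast
qed

lemma run_block:
  assumes run: "reaches T (block i k) C" and halt: "step T (block i k) C = None"
    and bound: "\<And>C. reaches T (block i k) C \<Longrightarrow> work_pos C + 1 \<le> K"
  shows "bounded_run (completer T bg) x (K + 1)
       (cfg Dispatch (length pre + 1) (\<lambda>_. 0) 0 out)
       (cfg Dispatch (length pre + (i + k) + 1) (\<lambda>_. 0) 0 (out @ written C))"
proof -
  let ?M = "completer T bg"
  obtain mo m where sim: "bounded_run ?M x (K + 1)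
       (cfg (Sim (start T) At_left) (length pre) (\<lambda>_. 0) 0 out)
       (cfg (Sim (cstate C) mo) (length pre + in_pos C) (\<lambda>p. if p < m then Suc (work C p) else 0)
          (work_pos C) (out @ written C))"
     and vw: "view mo (scan x (length pre + in_pos C)) = scan (block i k) (in_pos C)"
     and p: "in_pos C \<le> i + k + 1" and blank: "\<forall>p\<ge>m. work C p = blank T"
     and h: "work_pos C \<le> m" and m: "m \<le> K"
    using run_simulation[OF run bound, of bg out] by blast
  define wk where "wk = (\<lambda>p. if p < m then Suc (work C p) else 0)"
  note sim = sim[folded wk_def]
  let ?v = "scan (block i k) (in_pos C)"
  let ?h = "work_pos C" and ?out = "out @ written C" and ?p = "in_pos C"
  have hK: "?h < K + 1" using h m by simp
  have "bounded_step ?M x (K + 1) (cfg Dispatch (length pre + 1) (\<lambda>_. 0) 0 out)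
      (cfg (Sim (start T) At_left) (length pre) (\<lambda>_. 0) 0 out)"
    by (rule bounded_step_completer[where d = Go_left and e = Stay])
      (use scan_a[of 1] i in_range[of 0] in auto)
  then have "bounded_run ?M x (K + 1) (cfg Dispatch (length pre + 1) (\<lambda>_. 0) 0 out)
      (cfg (Sim (cstate C) mo) (length pre + ?p) wk ?h ?out)"
    using sim by (rule converse_rtranclp_into_rtranclp)
  also have "bounded_run ?M x (K + 1) (cfg (Sim (cstate C) mo) (length pre + ?p) wk ?h ?out)
      (cfg Seek_fresh (length pre + (i + k + 1)) wk ?h ?out)"
  proof -
    have scanned: "(case wk ?h of 0 \<Rightarrow> blank T | Suc c \<Rightarrow> c) = work C ?h"
      using blank by (auto simp: wk_def)
    have "trans T (cstate C) ?v (work C ?h) = None"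
      using halt unfolding step_def by (auto split: option.splits)
    then have tr: "phase_trans T bg (Sim (cstate C) mo) (scan x (length pre + ?p)) (wk ?h) =
        Some (if ?v = Left_end \<or> ?v = Inp Sa then Skip_as else Skip_bs, wk ?h,
                     if ?v = Left_end then Go_right else Stay, Stay, [])"
      by (simp only: phase_trans.simps Let_def vw scanned option.case)
    show ?thesis
    proof (cases "?p \<le> i")
      case True
      let ?p' = "if ?p = 0 then 1 else ?p"
      have "phase_trans T bg (Sim (cstate C) mo) (scan x (length pre + ?p)) (wk ?h) =
          Some (Skip_as, wk ?h, if ?p = 0 then Go_right else Stay, Stay, [])"
        unfolding tr using True by (auto simp: scan_block)
      then have "bounded_step ?M x (K + 1) (cfg (Sim (cstate C) mo) (length pre + ?p) wk ?h ?out)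
          (cfg Skip_as (length pre + ?p') wk ?h ?out)"
        by (rule bounded_step_completer) (use True hK in_range[of ?p'] k in auto)
      also have "bounded_run ?M x (K + 1) (cfg Skip_as (length pre + ?p') wk ?h ?out)
          (cfg Skip_bs (length pre + (i + 1)) wk ?h ?out)"
        by (rule run_skip_as) (use True i hK in auto)
      also have "bounded_run ?M x (K + 1) (cfg Skip_bs (length pre + (i + 1)) wk ?h ?out)
          (cfg Seek_fresh (length pre + (i + k + 1)) wk ?h ?out)"
        by (rule run_skip_bs) (use k hK in auto)
      finally show ?thesis .
    next
      case False
      have "phase_trans T bg (Sim (cstate C) mo) (scan x (length pre + ?p)) (wk ?h) =
          Some (Skip_bs, wk ?h, Stay, Stay, [])"
        unfolding tr using False by (auto simp: scan_block)
      then have "bounded_step ?M x (K + 1) (cfg (Sim (cstate C) mo) (length pre + ?p) wk ?h ?out)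
          (cfg Skip_bs (length pre + ?p) wk ?h ?out)"
        by (rule bounded_step_completer) (use hK in_range[OF p] in auto)
      also have "bounded_run ?M x (K + 1) (cfg Skip_bs (length pre + ?p) wk ?h ?out)
          (cfg Seek_fresh (length pre + (i + k + 1)) wk ?h ?out)"
        by (rule run_skip_bs) (use False p hK in auto)
      finally show ?thesis .
    qed
  qed
  also have "bounded_run ?M x (K + 1) (cfg Seek_fresh (length pre + (i + k + 1)) wk ?h ?out)
      (cfg Dispatch (length pre + (i + k + 1)) (\<lambda>_. 0) 0 ?out)"
    by (rule run_clean[of _ m]) (use h m in_range[of "i + k + 1"] in \<open>auto simp: wk_def\<close>)
  finally show ?thesis by (simp add: add.assoc)
qed

end

section \<open>Completing a word in logarithmic space\<close>

lemma last_enc: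
  assumes "w \<in> lists (letters \<Gamma>)" shows "enc w = [] \<or> last (enc w) \<noteq> Sa"
  using assms by (induction w rule: rev_induct) (auto simp: enc_def letters_def last_append)

lemma hd_enc:
  assumes "w \<in> lists (letters \<Gamma>)" shows "enc w = [] \<or> hd (enc w) \<noteq> Sb"
  using assms by (cases w) (auto simp: enc_def letters_def hd_append)

lemma enc_append: "enc (v @ w) = enc v @ enc w"
  by (simp add: enc_def)

text \<open>The blocks are processed independently, because each starts and ends with a clean work tape; the
  space \<open>K\<close> is reused for all of them.\<close>

lemma run_word:
  assumes tau: "\<And>i j. Tau i j \<in> set w \<Longrightarrow> \<exists>C. reaches T (enc [Tau i j]) C \<and>
        step T (enc [Tau i j]) C = None \<and> written C = enc (bt i j)"
    and bound: "\<And>i j C. Tau i j \<in> set w \<Longrightarrow> reaches T (enc [Tau i j]) C \<Longrightarrow> work_pos C + 1 \<le> K"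
    and w: "w \<in> lists (letters \<Gamma>)"
  shows "w = u @ v \<Longrightarrow> bounded_run (completer T bg) (enc w) (K + 1) (init_config (completer T bg))
    (cfg Dispatch (length (enc u) + 1) (\<lambda>_. 0) 0 (enc (complete_word bg bt u)))"
proof (induction u arbitrary: v rule: rev_induct)
  case Nil
  have "bounded_step (completer T bg) (enc w) (K + 1) (cfg Dispatch 0 (\<lambda>_. 0) 0 [])
    (cfg Dispatch 1 (\<lambda>_. 0) 0 [])"
    by (rule bounded_step_completer[where d = Go_right and e = Stay]) (auto simp: scan_def)
  then show ?case
    by (intro r_into_rtranclp) (simp add: init_config_def completer_def enc_def complete_word_def)
next
  case (snoc a u)
  have IH: "bounded_run (completer T bg) (enc w) (K + 1) (init_config (completer T bg))
    (cfg Dispatch (length (enc u) + 1) (\<lambda>_. 0) 0 (enc (complete_word bg bt u)))"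
    by (rule snoc.IH[of "a # v"]) (simp add: snoc.prems)
  have uv: "u \<in> lists (letters \<Gamma>)" "v \<in> lists (letters \<Gamma>)" "a \<in> letters \<Gamma>" "a \<in> set w"
    using w unfolding snoc.prems by auto
  have x: "enc w = enc u @ enc_letter a @ enc v" unfolding snoc.prems by (simp add: enc_def)
  have "bounded_run (completer T bg) (enc w) (K + 1)
    (cfg Dispatch (length (enc u) + 1) (\<lambda>_. 0) 0 (enc (complete_word bg bt u)))
    (cfg Dispatch (length (enc u) + length (enc_letter a) + 1) (\<lambda>_. 0) 0
      (enc (complete_word bg bt u) @ enc (complete_letter bg bt a)))"
  proof (cases a)
    case (Gen \<gamma>)
    have "scan (enc w) (length (enc u) + 1) = Inp (Sgen \<gamma>)"
      using scan_after[of "enc u" "Sgen \<gamma> # enc v"] by (simp add: x Gen)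
    then have "bounded_step (completer T bg) (enc w) (K + 1)
      (cfg Dispatch (length (enc u) + 1) (\<lambda>_. 0) 0 (enc (complete_word bg bt u)))
      (cfg Dispatch (length (enc u) + length (enc_letter a) + 1) (\<lambda>_. 0) 0
        (enc (complete_word bg bt u) @ enc (complete_letter bg bt a)))"
      by (intro bounded_step_completer[where d = Go_right and e = Stay])
        (simp_all add: x Gen fun_eq_iff)
    then show ?thesis by (rule r_into_rtranclp)
  next
    case (Tau i j)
    have ij: "1 \<le> i" "i < j" using uv(3) by (auto simp: Tau letters_def)
    have blk: "enc [Tau i j] = block i (j - i)" by (simp add: enc_def)
    interpret block_in_context "enc u" "enc v" i "j - i" "enc w"
      by standard (use ij x last_enc[OF uv(1)] hd_enc[OF uv(2)] in \<open>auto simp: Tau\<close>)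
    obtain C where C: "reaches T (enc [Tau i j]) C" "step T (enc [Tau i j]) C = None"
        "written C = enc (bt i j)"
      using tau uv(4) unfolding Tau by blast
    show ?thesis
      using run_block[OF C(1,2)[unfolded blk] bound[OF uv(4)[unfolded Tau], unfolded blk],
          of bg "enc (complete_word bg bt u)"] C(3) ij
      by (simp add: Tau add.assoc)
  qed
  with IH have "bounded_run (completer T bg) (enc w) (K + 1) (init_config (completer T bg))
    (cfg Dispatch (length (enc u) + length (enc_letter a) + 1) (\<lambda>_. 0) 0
      (enc (complete_word bg bt u) @ enc (complete_letter bg bt a)))"
    by (rule rtranclp_trans)
  then show ?case by (simp add: enc_append complete_word_def) (simp add: enc_def)
qed

lemma length_enc_Tau_le:
  assumes "Tau i j \<in> set w" shows "length (enc [Tau i j]) \<le> length (enc w)"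
proof -
  obtain u v where "w = u @ [Tau i j] @ v" using split_list[OF assms] by auto
  then show ?thesis by (simp add: enc_def)
qed

text \<open>The encoding of \<open>\<tau>\<^sub>i\<^sub>,\<^sub>j\<close> has length \<open>j\<close> and is a part of the encoding of \<open>w\<close>. So the logarithmic bound for
  the machine that completes single transpositions is also logarithmic in the length of the whole
  input, and the single extra cell increases the constant by one.\<close>

lemma logspace_complete_word:
  assumes fin: "finite \<Gamma>" "finite \<Delta>"
    and bg: "\<And>\<gamma>. \<gamma> \<in> \<Gamma> \<Longrightarrow> bg \<gamma> \<in> lists (letters \<Delta>)"
    and bt: "logspace_computable (symbs {}) (symbs \<Delta>) {(i, j). 1 \<le> i \<and> i < j}
       (\<lambda>(i, j). enc [Tau i j]) (\<lambda>(i, j). enc (bt i j))"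
  shows "logspace_computable (symbs \<Gamma>) (symbs \<Delta>) (lists (letters \<Gamma>))
           enc (\<lambda>w. enc (complete_word bg bt w))"
proof -
  let ?D = "{(i, j). 1 \<le> i \<and> i < j} :: (nat \<times> nat) set"
  let ?inp = "\<lambda>(i, j). enc [Tau i j]" and ?val = "\<lambda>(i, j). enc (bt i j)"
  obtain T :: "(symb, symb) transducer" and k :: nat where
    T: "transducer_over (symbs {}) (symbs \<Delta>) T"
    and run': "\<forall>d\<in>?D. \<exists>C. reaches T (?inp d) C \<and> step T (?inp d) C = None \<and> written C = ?val d"
    and space': "\<forall>d\<in>?D. \<forall>C. reaches T (?inp d) C \<longrightarrow>
        real (work_pos C + 1) \<le> real k * log 2 (real (length (?inp d) + 2))"
    using bt unfolding logspace_computable_def by (elim conjE exE) (rule that)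
  have run: "\<exists>C. reaches T (enc [Tau i j]) C \<and> step T (enc [Tau i j]) C = None \<and> written C = enc (bt i j)"
    if "1 \<le> i" "i < j" for i j using bspec[OF run', of "(i, j)"] that by simp
  have space: "real (work_pos C + 1) \<le> real k * log 2 (real (length (enc [Tau i j]) + 2))"
    if "1 \<le> i" "i < j" "reaches T (enc [Tau i j]) C" for i j C
    using bspec[OF space', of "(i, j)"] that by simp
  let ?M = "completer T bg"
  have word: "\<exists>C. reaches ?M (enc w) C \<and> step ?M (enc w) C = None \<and>
        written C = enc (complete_word bg bt w) \<and>
        (\<forall>D. reaches ?M (enc w) D \<longrightarrow>
           real (work_pos D + 1) \<le> real (k + 1) * log 2 (real (length (enc w) + 2)))"
    if w: "w \<in> lists (letters \<Gamma>)" for w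
  proof -
    define L where "L = log 2 (real (length (enc w) + 2))"
    define K where "K = nat \<lfloor>real k * L\<rfloor>"
    have L: "1 \<le> L" unfolding L_def by (simp add: le_log_iff)
    have ij: "1 \<le> i \<and> i < j" if "Tau i j \<in> set w" for i j
      using that w by (auto simp: letters_def in_lists_conv_set)
    have bound: "work_pos C + 1 \<le> K"
      if "Tau i j \<in> set w" "reaches T (enc [Tau i j]) C" for i j C
    proof -
      have "log 2 (real (length (enc [Tau i j]) + 2)) \<le> L"
        unfolding L_def using length_enc_Tau_le[OF that(1)] by (subst log_le_cancel_iff) auto
      then have "real k * log 2 (real (length (enc [Tau i j]) + 2)) \<le> real k * L"
        by (rule mult_left_mono) simp
      then have "real (work_pos C + 1) \<le> real k * L"
        using space[of i j C] ij[OF that(1)] that(2) by linarith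
      then show ?thesis unfolding K_def by (simp add: le_nat_floor)
    qed
    let ?C = "cfg Dispatch (length (enc w) + 1) (\<lambda>_. 0) 0 (enc (complete_word bg bt w))"
    have brun: "bounded_run ?M (enc w) (K + 1) (init_config ?M) ?C"
      by (rule run_word[of w T bt K \<Gamma> w "[]"]) (use run ij bound w in auto)
    have halt: "step ?M (enc w) ?C = None"
      by (simp add: step_def completer_def scan_def)
    have "real (work_pos D + 1) \<le> real (k + 1) * L" if "reaches ?M (enc w) D" for D
    proof -
      have "work_pos D < K + 1" using bounded_run_bounds_reachable[OF brun halt _ that] by simp
      then have "real (work_pos D + 1) \<le> real K + 1" by simp
      also have "real K \<le> real k * L" unfolding K_def using L by (simp add: of_nat_floor)
      finally show ?thesis using L by (simp add: algebra_simps)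
    qed
    then show ?thesis using bounded_run_reaches[OF brun] halt unfolding L_def by force
  qed
  have "\<exists>T :: (symb, symb) transducer. transducer_over (symbs \<Gamma>) (symbs \<Delta>) T \<and>
        (\<forall>d\<in>lists (letters \<Gamma>). \<exists>C. reaches T (enc d) C \<and> step T (enc d) C = None \<and>
            written C = enc (complete_word bg bt d)) \<and>
        (\<exists>k::nat. \<forall>d\<in>lists (letters \<Gamma>). \<forall>C. reaches T (enc d) C \<longrightarrow>
           real (work_pos C + 1) \<le> real k * log 2 (real (length (enc d) + 2)))"
    using completer_transducer_over[of \<Delta> T \<Gamma> bg, OF T fin bg] word
    by (intro exI[of _ ?M] conjI exI[of _ "k + 1"]) blast+
  then show ?thesis unfolding logspace_computable_def using symbs_enc by blast
qed

theorem corollary9p7: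
  fixes \<Gamma>_M \<Gamma>_tot :: "elem set"
    and bar_gen :: "elem \<Rightarrow> letter list"
    and bar_tau :: "nat \<Rightarrow> nat \<Rightarrow> letter list"
  assumes "finite \<Gamma>_M" and "\<Gamma>_M \<subseteq> M21" and "generates_with_tau \<Gamma>_M M21"
    and "finite \<Gamma>_tot" and "\<Gamma>_tot \<subseteq> totM21" and "generates_with_tau \<Gamma>_tot totM21"
    and "\<And>\<gamma>. \<gamma> \<in> \<Gamma>_M \<Longrightarrow> bar_gen \<gamma> \<in> lists (letters \<Gamma>_tot)"
    and "\<And>\<gamma>. \<gamma> \<in> \<Gamma>_M \<Longrightarrow> E (bar_gen \<gamma>) \<in> completions \<gamma>"
    and "\<And>i j. 1 \<le> i \<Longrightarrow> i < j \<Longrightarrow> bar_tau i j \<in> lists (letters \<Gamma>_tot)"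
    and "\<And>i j x. 1 \<le> i \<Longrightarrow> i < j \<Longrightarrow> act (E (bar_tau i j)) (False ## x) = Some (False ## x)"
    and "\<And>i j x. 1 \<le> i \<Longrightarrow> i < j \<Longrightarrow>
           act (E (bar_tau i j)) (True ## x) = act (tau (i + 1) (j + 1)) (True ## x)"
    and "logspace_computable (symbs {}) (symbs \<Gamma>_tot) {(i, j). 1 \<le> i \<and> i < j}
           (\<lambda>(i, j). enc [Tau i j]) (\<lambda>(i, j). enc (bar_tau i j))"
  shows "(\<forall>w \<in> lists (letters \<Gamma>_M).
            let W = complete_word bar_gen bar_tau w in
              W \<in> lists (letters \<Gamma>_tot) \<and>
              E W = M_prod (map (\<lambda>a. E (complete_letter bar_gen bar_tau a)) w) \<and>
              E W \<in> F0 \<and>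
              E W \<in> completions (E w) \<and>
              rho (E W) = E w) \<and>
         logspace_computable (symbs \<Gamma>_M) (symbs \<Gamma>_tot) (lists (letters \<Gamma>_M))
           enc (\<lambda>w. enc (complete_word bar_gen bar_tau w))"
proof (intro conjI ballI)
  have tot: "\<Gamma>_tot \<subseteq> M21" using assms(5) by (auto simp: totM21_def)
  let ?bar = "complete_letter bar_gen bar_tau"
  have word: "?bar a \<in> lists (letters \<Gamma>_tot)" if "a \<in> letters \<Gamma>_M" for a
  proof (cases a)
    case (Gen \<gamma>)
    then have "\<gamma> \<in> \<Gamma>_M" using that by (auto simp: letters_def)
    then show ?thesis unfolding Gen using assms(7) by simp
  next
    case (Tau i j)
    then have "1 \<le> i" "i < j" using that by (auto simp: letters_def)
    then show ?thesis unfolding Tau using assms(9) by simp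
  qed
  have compl: "E (?bar a) \<in> completions (letter_elem a)" if a: "a \<in> letters \<Gamma>_M" for a
  proof (cases a)
    case (Gen \<gamma>)
    then have "\<gamma> \<in> \<Gamma>_M" using a by (auto simp: letters_def)
    then show ?thesis unfolding Gen using assms(8) by simp
  next
    case (Tau i j)
    then have ij: "1 \<le> i" "i < j" using a by (auto simp: letters_def)
    note F0_rho_tau[OF ij E_in_M21[OF tot assms(9)[OF ij]] assms(10)[OF ij] assms(11)[OF ij]]
    then show ?thesis by (simp add: Tau completions_def)
  qed
  show "let W = complete_word bar_gen bar_tau w in
      W \<in> lists (letters \<Gamma>_tot) \<and>
      E W = M_prod (map (\<lambda>a. E (complete_letter bar_gen bar_tau a)) w) \<and>
      E W \<in> F0 \<and> E W \<in> completions (E w) \<and> rho (E W) = E w"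
    if w: "w \<in> lists (letters \<Gamma>_M)" for w
    using complete_word_correct[OF tot word compl w] by (simp add: completions_def Let_def)
  show "logspace_computable (symbs \<Gamma>_M) (symbs \<Gamma>_tot) (lists (letters \<Gamma>_M))
      enc (\<lambda>w. enc (complete_word bar_gen bar_tau w))"
    by (rule logspace_complete_word[OF assms(1,4,7,12)])
qed

end
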